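(* Let $G$ be a connected graph of order $n$ with diameter $d$. (i) If $d=2$, or $d=\frac{n+2}{2}$, or $d=\frac{n+3}{2}$, then $m_G[n-2d+4,n]\le n-2$. (ii) If $3\le d\le \lfloor\frac{n+1}{2}\rfloor$, then $m_G[n-2d+4,n]\le n-3$.
   Context: All graphs are finite, simple and undirected; the order of a graph is its number of vertices. For a graph $G$ of order $n$, the Laplacian matrix is $L(G)=D(G)-A(G)$, where $A(G)$ is the adjacency matrix and $D(G)$ is the diagonal matrix of vertex degrees; its $n$ real eigenvalues (counted with multiplicity) are the Laplacian eigenvalues of $G$, and all of them lie in $[0,n]$. For an interval $I\subseteq[0,n]$, $m_GI$ denotes the number of Laplacian eigenvalues of $G$ lying in $I$, counted with multiplicities; thus $m_G[a,n]$ is the number of Laplacian eigenvalues of $G$ in the closed interval $[a,n]$. The diameter of a connected graph is the maximum distance over all pairs of its vertices. *)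

theory Defs
  imports
    "Graph_Theory.Graph_Theory"
    "Jordan_Normal_Form.Char_Poly"
    "HOL-Computational_Algebra.Computational_Algebra"
begin

text \<open>
  A finite simple undirected graph is a \<open>graph\<close> in the sense of the AFP entry Graph\_Theory:
  finitely many vertices and arcs, no loops, no parallel arcs, and a symmetric adjacency relation,
  each undirected edge \<open>uv\<close> being the pair of arcs \<open>(u, v)\<close> and \<open>(v, u)\<close>. Hence \<open>out_degree\<close> is
  the usual vertex degree.
\<close>

definition graph_dist :: "('a, 'b) pre_digraph \<Rightarrow> 'a \<Rightarrow> 'a \<Rightarrow> ereal" where
  "graph_dist G u v = wf_digraph.\<mu> G (\<lambda>_. 1) u v"

definition graph_diameter :: "('a, 'b) pre_digraph \<Rightarrow> ereal" where
  "graph_diameter G = Max {graph_dist G u v |u v. u \<in> verts G \<and> v \<in> verts G}"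

text \<open>The list \<open>vs\<close> is the ordering of the vertices used to index rows and columns.\<close>

definition adjacency_mat :: "('a, 'b) pre_digraph \<Rightarrow> 'a list \<Rightarrow> real mat" where
  "adjacency_mat G vs = mat (length vs) (length vs)
     (\<lambda>(i, j). if vs ! i \<rightarrow>\<^bsub>G\<^esub> vs ! j then 1 else 0)"

definition degree_mat :: "('a, 'b) pre_digraph \<Rightarrow> 'a list \<Rightarrow> real mat" where
  "degree_mat G vs = mat (length vs) (length vs)
     (\<lambda>(i, j). if i = j then real (out_degree G (vs ! i)) else 0)"

definition laplacian_mat :: "('a, 'b) pre_digraph \<Rightarrow> 'a list \<Rightarrow> real mat" where
  "laplacian_mat G vs = degree_mat G vs - adjacency_mat G vs"

text \<open>
  The eigenvalues with multiplicity are the roots, with multiplicity, of the characteristic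
  polynomial of the Laplacian matrix; all roots are real, since that matrix is symmetric.
  The choice of the vertex ordering is immaterial by \<open>laplacian_eigenvalues_eq\<close> below.
\<close>

definition laplacian_eigenvalues :: "('a, 'b) pre_digraph \<Rightarrow> real multiset" where
  "laplacian_eigenvalues G =
     proots (char_poly (laplacian_mat G (SOME vs. distinct vs \<and> set vs = verts G)))"

definition laplacian_count :: "('a, 'b) pre_digraph \<Rightarrow> real set \<Rightarrow> nat" where
  "laplacian_count G I = size (filter_mset (\<lambda>x. x \<in> I) (laplacian_eigenvalues G))"

lemma char_poly_permute:
  fixes A :: "'a :: comm_ring_1 mat"
  assumes A: "A \<in> carrier_mat n n" and p: "p permutes {0..<n}"
  shows "char_poly (mat n n (\<lambda>(i, j). A $$ (p i, p j))) = char_poly A"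
proof -
  let ?C = "char_poly_matrix A"
  let ?R = "mat n n (\<lambda>(i, j). ?C $$ (p i, j))"
  have C: "?C \<in> carrier_mat n n" using A by simp
  have lt: "p i < n" if "i < n" for i using that permutes_in_image[OF p, of i] by simp
  have inj: "p i = p j \<longleftrightarrow> i = j" for i j using permutes_inj[OF p] by (auto dest: injD)
  have "char_poly_matrix (mat n n (\<lambda>(i, j). A $$ (p i, p j))) =
        (mat n n (\<lambda>(i, j). ?R\<^sup>T $$ (p i, j)))\<^sup>T"
    using A by (intro eq_matI) (auto simp: char_poly_matrix_def lt inj)
  then have "char_poly (mat n n (\<lambda>(i, j). A $$ (p i, p j))) =
             det (mat n n (\<lambda>(i, j). ?R\<^sup>T $$ (p i, j)))"
    unfolding char_poly_def by (simp add: det_transpose[of _ n])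
  also have "\<dots> = signof p * det (?R\<^sup>T)"
    by (rule det_permute_rows[OF _ p]) simp
  also have "det (?R\<^sup>T) = det ?R"
    by (rule det_transpose[of _ n]) simp
  also have "det ?R = signof p * det ?C"
    by (rule det_permute_rows[OF C p])
  also have "signof p * (signof p * det ?C) = det ?C"
    by (simp add: sign_def)
  finally show ?thesis unfolding char_poly_def .
qed

lemma char_poly_laplacian_mat_cong:
  assumes "distinct vs" "distinct ws" "set vs = set ws"
  shows "char_poly (laplacian_mat G vs) = char_poly (laplacian_mat G ws)"
proof -
  have "mset vs = mset ws"
    using assms by (simp add: set_eq_iff_mset_eq_distinct)
  then obtain p where p: "p permutes {..<length ws}" and vs: "permute_list p ws = vs"
    by (rule mset_eq_permutation)
  have len: "length vs = length ws" using vs by auto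
  have lt: "p i < length ws" if "i < length ws" for i
    using that permutes_in_image[OF p, of i] by simp
  have inj: "p i = p j \<longleftrightarrow> i = j" for i j using permutes_inj[OF p] by (auto dest: injD)
  have nth: "vs ! i = ws ! p i" if "i < length ws" for i
    using that vs permute_list_nth[OF p] by auto
  have "laplacian_mat G vs =
        mat (length ws) (length ws) (\<lambda>(i, j). laplacian_mat G ws $$ (p i, p j))"
    by (intro eq_matI)
       (auto simp: laplacian_mat_def degree_mat_def adjacency_mat_def len lt inj nth)
  moreover have "laplacian_mat G ws \<in> carrier_mat (length ws) (length ws)"
    by (auto simp: laplacian_mat_def degree_mat_def adjacency_mat_def)
  ultimately show ?thesis
    using char_poly_permute p by (metis atLeast0LessThan)
qed

lemma laplacian_eigenvalues_eq:
  assumes "distinct vs" "set vs = verts G"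
  shows "laplacian_eigenvalues G = proots (char_poly (laplacian_mat G vs))"
proof -
  let ?ws = "SOME ws. distinct ws \<and> set ws = verts G"
  have "distinct ?ws \<and> set ?ws = verts G"
    by (rule someI[of _ vs]) (use assms in simp)
  then show ?thesis
    unfolding laplacian_eigenvalues_def using assms char_poly_laplacian_mat_cong by metis
qed

end

theory Submission
  imports Defs "Jordan_Normal_Form.Spectral_Radius"
begin

text \<open>
  A bound \<open>k\<close> for the number of Laplacian eigenvalues in \<open>[t, n]\<close> means that at least \<open>n - k\<close> eigenvalues
  lie below \<open>t\<close>. By the Courant-Fischer principle (\<open>size_filter_eigenvalues_add_le\<close>) it suffices to
  exhibit a space of that dimension on which the Laplacian quadratic form is smaller than \<open>t\<close> times the
  squared norm, without solving for a single eigenvalue.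
  
  The first reduction concerns \<open>t = n - 2 * d + 4\<close>, which grows with \<open>n\<close>. Deleting a vertex lowers the
  threshold by one: test functions on a subset \<open>S\<close> of the vertices with threshold \<open>s\<close> extend by their
  mean values to test functions on the graph with threshold \<open>s + n - card S\<close>
  (\<open>dirichlet_mean_extension\<close>). For \<open>3 \<le> d\<close> and \<open>2 * d \<le> n + 1\<close> one may therefore keep only \<open>2 * d - 1\<close>
  vertices and aim for the threshold \<open>3\<close>; for \<open>d = 2\<close> one keeps two vertices at distance \<open>2\<close> and aims
  for \<open>2\<close>. In the other two cases all vertices are kept, with thresholds \<open>2\<close> for \<open>n = 2 * d - 2\<close> and \<open>1\<close>
  for \<open>n = 2 * d - 3\<close>.
  
  The second reduction arranges the vertices in layers \<open>0, \<dots>, d\<close> by their distance from an end of a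
  diametral path, with single vertices in the first and the last layer (\<open>diameter_layering\<close>). Edges
  join vertices of equal or consecutive layers, and adding edges only increases the form. So for
  functions that are constant on layers only the sizes of the layers matter
  (\<open>laplacian_count_layers\<close>).
  
  Finally the layer sizes are counted. In all cases there are fewer than \<open>2 * (d - 1)\<close> vertices for
  \<open>d - 1\<close> nonempty interior layers (apart from \<open>d = 2\<close>), so some interior layer is a singleton, a cut
  vertex. The indicator functions of the parts that cut vertices separate have small energy, as
  each outside vertex has at most one edge to each cut vertex. One cut vertex gives two test functions,
  and two nonconsecutive ones give three. When \<open>2 * d - 1\<close> vertices do not provide two such cut
  vertices, the layer sizes are almost determined, and the end vertices of the path serve as further
  test functions (\<open>ex_negative_blocks_dim_3\<close>).
\<close>

(* The dollar sign stands for the entries of vectors only. *)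
no_notation fps_nth (infixl \<open>$\<close> 75)

section \<open>Orthogonal diagonalization of real symmetric matrices\<close>

lemma symmetric_mat_mult_vec_swap:
  fixes A :: "real mat"
  assumes A: "A \<in> carrier_mat n n" and sym: "A\<^sup>T = A"
    and x: "x \<in> carrier_vec n" and y: "y \<in> carrier_vec n"
  shows "(A *\<^sub>v y) \<bullet> x = (A *\<^sub>v x) \<bullet> y"
proof -
  have "(A *\<^sub>v y) \<bullet> x = y \<bullet> (A *\<^sub>v x)"
    using transpose_vec_mult_scalar[OF A x y] sym by simp
  also have "\<dots> = (A *\<^sub>v x) \<bullet> y"
    by (rule comm_scalar_prod[of _ n]) (use A x y in auto)
  finally show ?thesis .
qed

text \<open>
  The matrix has a complex eigenvalue by the fundamental theorem of algebra. Splitting the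
  eigenvector into real and imaginary parts shows that the eigenvalue is real, and one of the
  two parts is then a real eigenvector.
\<close>

lemma symmetric_mat_unit_eigenvector:
  fixes A :: "real mat"
  assumes A: "A \<in> carrier_mat n n" and sym: "A\<^sup>T = A" and n: "0 < n"
  obtains v l where "v \<in> carrier_vec n" "v \<bullet> v = 1" "A *\<^sub>v v = l \<cdot>\<^sub>v v"
proof -
  let ?C = "map_mat complex_of_real A"
  have C: "?C \<in> carrier_mat n n" using A by simp
  obtain k where "eigenvalue ?C k"
    using spectrum_non_empty[OF C n] unfolding spectrum_def by auto
  then obtain z where z: "z \<in> carrier_vec n" "z \<noteq> 0\<^sub>v n" and ev: "?C *\<^sub>v z = k \<cdot>\<^sub>v z"
    using A unfolding eigenvalue_def eigenvector_def by auto
  define a where "a = map_vec Re z"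
  define b where "b = map_vec Im z"
  have a: "a \<in> carrier_vec n" and b: "b \<in> carrier_vec n" using z by (auto simp: a_def b_def)
  have entry: "(\<Sum>j<n. complex_of_real (A $$ (i, j)) * z $ j) = k * z $ i" if "i < n" for i
  proof -
    have "(?C *\<^sub>v z) $ i = (\<Sum>j<n. complex_of_real (A $$ (i, j)) * z $ j)"
      using A z that by (auto simp: scalar_prod_def atLeast0LessThan intro!: sum.cong)
    then show ?thesis using ev z that by simp
  qed
  have Aa: "A *\<^sub>v a = Re k \<cdot>\<^sub>v a - Im k \<cdot>\<^sub>v b"
  proof (rule eq_vecI)
    fix i assume "i < dim_vec (Re k \<cdot>\<^sub>v a - Im k \<cdot>\<^sub>v b)"
    then have i: "i < n" using b by simp
    have "(A *\<^sub>v a) $ i = Re (\<Sum>j<n. complex_of_real (A $$ (i, j)) * z $ j)"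
      using A z i by (auto simp: scalar_prod_def atLeast0LessThan a_def intro!: sum.cong)
    then show "(A *\<^sub>v a) $ i = (Re k \<cdot>\<^sub>v a - Im k \<cdot>\<^sub>v b) $ i"
      using entry[OF i] i z by (simp add: a_def b_def)
  qed (use A b in auto)
  have Ab: "A *\<^sub>v b = Re k \<cdot>\<^sub>v b + Im k \<cdot>\<^sub>v a"
  proof (rule eq_vecI)
    fix i assume "i < dim_vec (Re k \<cdot>\<^sub>v b + Im k \<cdot>\<^sub>v a)"
    then have i: "i < n" using a by simp
    have "(A *\<^sub>v b) $ i = Im (\<Sum>j<n. complex_of_real (A $$ (i, j)) * z $ j)"
      using A z i by (auto simp: scalar_prod_def atLeast0LessThan b_def intro!: sum.cong)
    then show "(A *\<^sub>v b) $ i = (Re k \<cdot>\<^sub>v b + Im k \<cdot>\<^sub>v a) $ i"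
      using entry[OF i] i z by (simp add: a_def b_def)
  qed (use A a in auto)
  have nz: "a \<noteq> 0\<^sub>v n \<or> b \<noteq> 0\<^sub>v n"
  proof (rule ccontr)
    assume "\<not> (a \<noteq> 0\<^sub>v n \<or> b \<noteq> 0\<^sub>v n)"
    then have "\<And>i. i < n \<Longrightarrow> Re (z $ i) = 0 \<and> Im (z $ i) = 0"
      using z unfolding a_def b_def by (metis carrier_vecD index_map_vec(1) index_zero_vec(1))
    then have "z = 0\<^sub>v n" using z by (intro eq_vecI) (auto simp: complex_eq_iff)
    with z show False by simp
  qed
  have pos: "0 < x \<bullet> x" if "x \<in> carrier_vec n" "x \<noteq> 0\<^sub>v n" for x :: "real vec"
    using that conjugate_square_greater_0_vec[of x n] by simp
  have nonneg: "0 \<le> x \<bullet> x" for x :: "real vec"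
    by (simp add: scalar_prod_def sum_nonneg)
  have "(A *\<^sub>v b) \<bullet> a = (A *\<^sub>v a) \<bullet> b"
    by (rule symmetric_mat_mult_vec_swap[OF A sym a b])
  \<comment> \<open>The imaginary part of the eigenvalue is the defect in the symmetry of the form
     at the real and imaginary parts of the eigenvector.\<close>
  then have "Im k * (a \<bullet> a + b \<bullet> b) = 0"
    unfolding Aa Ab using a b comm_scalar_prod[OF a b]
    by (simp add: add_scalar_prod_distrib[of _ n] minus_scalar_prod_distrib[of _ n] algebra_simps)
  moreover have "a \<bullet> a + b \<bullet> b > 0"
    using nz pos[OF a] pos[OF b] nonneg[of a] nonneg[of b] by linarith
  ultimately have "Im k = 0" by simp
  then have "A *\<^sub>v a = Re k \<cdot>\<^sub>v a" "A *\<^sub>v b = Re k \<cdot>\<^sub>v b"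
    unfolding Aa Ab using a b by auto
  then obtain w where w: "w \<in> carrier_vec n" "w \<noteq> 0\<^sub>v n" "A *\<^sub>v w = Re k \<cdot>\<^sub>v w"
    using nz a b by blast
  define r where "r = 1 / sqrt (w \<bullet> w)"
  have "(r \<cdot>\<^sub>v w) \<bullet> (r \<cdot>\<^sub>v w) = 1"
    using pos[OF w(1,2)] w(1) by (simp add: r_def)
  moreover have "A *\<^sub>v (r \<cdot>\<^sub>v w) = Re k \<cdot>\<^sub>v (r \<cdot>\<^sub>v w)"
    using w A by (simp add: mult_mat_vec smult_smult_assoc mult.commute)
  ultimately show thesis using that w(1) smult_carrier_vec by blast
qed

text \<open>
  The reflection in the hyperplane orthogonal to \<open>v - e\<^sub>0\<close> exchanges \<open>v\<close> and the first basis
  vector \<open>e\<^sub>0\<close>. It replaces an orthonormal completion of \<open>v\<close> to a basis, and as it is symmetric and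
  its own inverse, conjugation with it visibly preserves symmetry.
\<close>

lemma householder_reflection:
  fixes v :: "real vec"
  assumes v: "v \<in> carrier_vec (Suc n)" and unit: "v \<bullet> v = 1"
  obtains H where "H \<in> carrier_mat (Suc n) (Suc n)" "H\<^sup>T = H" "H * H = 1\<^sub>m (Suc n)"
    "col H 0 = v"
proof (cases "v = unit_vec (Suc n) 0")
  case True
  show ?thesis by (rule that[of "1\<^sub>m (Suc n)"]) (auto simp: True)
next
  case False
  define u where "u = v - unit_vec (Suc n) 0"
  have u: "u \<in> carrier_vec (Suc n)" using v by (simp add: u_def)
  define q where "q = u \<bullet> u"
  define c where "c = 2 / q"
  have unz: "u \<noteq> 0\<^sub>v (Suc n)"
  proof
    assume "u = 0\<^sub>v (Suc n)"
    then have "\<And>i. i < Suc n \<Longrightarrow> v $ i - unit_vec (Suc n) 0 $ i = 0"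
      using v unfolding u_def
      by (metis index_minus_vec(1) index_zero_vec(1) unit_vec_carrier carrier_vecD)
    then have "v = unit_vec (Suc n) 0" using v by (intro eq_vecI) auto
    with False show False by simp
  qed
  then have q0: "q > 0" using conjugate_square_greater_0_vec[OF u] by (simp add: q_def)
  have qsum: "(\<Sum>i<Suc n. u $ i * u $ i) = q"
    using u by (simp add: q_def scalar_prod_def atLeast0LessThan)
  have vsum: "(\<Sum>i<Suc n. v $ i * v $ i) = 1"
    using v unit by (simp add: scalar_prod_def atLeast0LessThan)
  have "q = (\<Sum>i<Suc n. v $ i * v $ i - 2 * (if i = 0 then v $ 0 else 0) + (if i = 0 then 1 else 0))"
    unfolding qsum[symmetric] using v
    by (intro sum.cong) (auto simp: u_def algebra_simps)
  also have "\<dots> = 2 - 2 * v $ 0"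
    using vsum by (simp add: sum.distrib sum_subtractf sum_distrib_left[symmetric] sum.delta)
  finally have q: "q = 2 - 2 * v $ 0" .
  have u0: "u $ 0 = v $ 0 - 1" using v by (simp add: u_def)
  have cu0: "c * u $ 0 = -1" using q q0 u0 by (simp add: c_def field_simps)
  define H where "H = mat (Suc n) (Suc n)
    (\<lambda>(i, j). (if i = j then 1 else 0) - c * u $ i * u $ j)"
  have HH: "H * H = 1\<^sub>m (Suc n)"
  proof (rule eq_matI)
    fix i j assume "i < dim_row (1\<^sub>m (Suc n) :: real mat)" "j < dim_col (1\<^sub>m (Suc n) :: real mat)"
    then have i: "i < Suc n" and j: "j < Suc n" by auto
    have "(H * H) $$ (i, j) = (\<Sum>k<Suc n.
        ((if i = k then 1 else 0) - c * u $ i * u $ k) * ((if k = j then 1 else 0) - c * u $ k * u $ j))"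
      using i j by (simp add: H_def scalar_prod_def atLeast0LessThan)
    also have "\<dots> = (\<Sum>k<Suc n. (if i = k then (if i = j then 1 else 0) - c * u $ i * u $ j else 0)
        - (if k = j then c * u $ i * u $ j else 0) + c * c * u $ i * u $ j * (u $ k * u $ k))"
      by (intro sum.cong) (auto simp: algebra_simps)
    also have "\<dots> = (if i = j then 1 else 0) - 2 * c * u $ i * u $ j + c * c * u $ i * u $ j * q"
      using i j unfolding qsum[symmetric]
      by (simp add: sum.distrib sum_subtractf sum_distrib_left[symmetric] sum.delta sum.delta' del: sum.lessThan_Suc)
    also have "\<dots> = (if i = j then 1 else 0)"
      using q0 by (simp add: c_def field_simps)
    finally show "(H * H) $$ (i, j) = 1\<^sub>m (Suc n) $$ (i, j)" using i j by simp
  qed (auto simp: H_def)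
  show ?thesis
  proof (rule that[of H])
    show "H\<^sup>T = H" unfolding H_def by (rule eq_matI) auto
    show "col H 0 = v"
    proof (rule eq_vecI)
      fix i assume "i < dim_vec v"
      then have i: "i < Suc n" using v by simp
      have "col H 0 $ i = (if i = 0 then 1 else 0) - (c * u $ 0) * u $ i"
        using i by (simp add: H_def algebra_simps)
      also have "\<dots> = v $ i" unfolding cu0 using i v by (simp add: u_def)
      finally show "col H 0 $ i = v $ i" .
    qed (use v in \<open>simp add: H_def\<close>)
  qed (use HH in \<open>auto simp: H_def\<close>)
qed

lemma mult_unit_vec_col:
  fixes A :: "'a :: semiring_1 mat"
  assumes "A \<in> carrier_mat m n" "j < n"
  shows "A *\<^sub>v unit_vec n j = col A j"
  using assms by (intro eq_vecI) auto

text \<open>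
  Induction on the size: conjugating with the reflection that sends \<open>e\<^sub>0\<close> to a unit eigenvector
  turns \<open>e\<^sub>0\<close> into an eigenvector, so the first column vanishes below the diagonal. By symmetry the
  first row does too, and what remains is a smaller symmetric block.
\<close>

lemma symmetric_mat_diagonalization:
  fixes A :: "real mat"
  assumes "A \<in> carrier_mat n n" and "A\<^sup>T = A"
  obtains Q f where "Q \<in> carrier_mat n n" "Q * Q\<^sup>T = 1\<^sub>m n" "A = Q * mat_diag n f * Q\<^sup>T"
proof -
  have "\<exists>Q f. Q \<in> carrier_mat n n \<and> Q * Q\<^sup>T = 1\<^sub>m n \<and> A = Q * mat_diag n f * Q\<^sup>T"
    using assms
  proof (induction n arbitrary: A)
    case 0
    show ?case
      by (rule exI[of _ "1\<^sub>m 0"], rule exI[of _ "\<lambda>_. 0"]) (use 0 in auto)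
  next
    case (Suc n)
    let ?n = "Suc n"
    note A = Suc.prems(1)
    obtain v l where v: "v \<in> carrier_vec ?n" "v \<bullet> v = 1" and Av: "A *\<^sub>v v = l \<cdot>\<^sub>v v"
      using symmetric_mat_unit_eigenvector[OF A Suc.prems(2)] by auto
    obtain H where H: "H \<in> carrier_mat ?n ?n" and HT: "H\<^sup>T = H" and HH: "H * H = 1\<^sub>m ?n"
      and Hcol: "col H 0 = v"
      using householder_reflection[OF v] by metis
    let ?e = "unit_vec ?n 0 :: real vec"
    have He: "H *\<^sub>v ?e = v" using H Hcol by (auto simp: mult_unit_vec_col)
    have Hv: "H *\<^sub>v v = ?e"
      using HH H He assoc_mult_mat_vec[OF H H, of ?e] by simp
    define B where "B = H * A * H"
    have B: "B \<in> carrier_mat ?n ?n" using A H by (simp add: B_def)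
    have BT: "B\<^sup>T = B"
    proof -
      have "B\<^sup>T = H\<^sup>T * (H * A)\<^sup>T"
        unfolding B_def by (rule transpose_mult[of _ ?n ?n _ ?n]) (use H A in auto)
      also have "(H * A)\<^sup>T = A\<^sup>T * H\<^sup>T"
        by (rule transpose_mult[OF H A])
      finally show ?thesis using H A HT Suc.prems(2) by (simp add: B_def)
    qed
    have "B *\<^sub>v ?e = H *\<^sub>v (A *\<^sub>v (H *\<^sub>v ?e))"
      unfolding B_def using H A He v
      by (simp add: assoc_mult_mat_vec[of _ ?n ?n _ ?n] mult_mat_vec_carrier[of _ ?n ?n]
          mult_carrier_mat[of _ ?n ?n _ ?n])
    also have "\<dots> = l \<cdot>\<^sub>v ?e"
      using He Av Hv H v by (simp add: mult_mat_vec)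
    finally have Be: "col B 0 = l \<cdot>\<^sub>v ?e" using B by (simp add: mult_unit_vec_col)
    have B0: "B $$ (i, 0) = (if i = 0 then l else 0)" if "i < ?n" for i
    proof -
      have "B $$ (i, 0) = col B 0 $ i" using B that by simp
      then show ?thesis unfolding Be using that by simp
    qed
    have B0': "B $$ (0, i) = (if i = 0 then l else 0)" if "i < ?n" for i
    proof -
      have "B $$ (0, i) = B\<^sup>T $$ (i, 0)" using B that by auto
      then show ?thesis unfolding BT using B0 that by simp
    qed
    define C where "C = mat n n (\<lambda>(i, j). B $$ (Suc i, Suc j))"
    have C: "C \<in> carrier_mat n n" by (simp add: C_def)
    have Bblock: "B = four_block_mat (mat 1 1 (\<lambda>_. l)) (0\<^sub>m 1 n) (0\<^sub>m n 1) C"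
    proof (rule eq_matI)
      fix i j
      assume "i < dim_row (four_block_mat (mat 1 1 (\<lambda>_. l)) (0\<^sub>m 1 n) (0\<^sub>m n 1) C)"
        "j < dim_col (four_block_mat (mat 1 1 (\<lambda>_. l)) (0\<^sub>m 1 n) (0\<^sub>m n 1) C)"
      then have "i < ?n" "j < ?n" using C by auto
      then show "B $$ (i, j) = four_block_mat (mat 1 1 (\<lambda>_. l)) (0\<^sub>m 1 n) (0\<^sub>m n 1) C $$ (i, j)"
        using C B0 B0' by (cases i; cases j) (auto simp: C_def)
    qed (use B C in auto)
    have "C\<^sup>T = C"
    proof (rule eq_matI)
      fix i j assume "i < dim_row C" "j < dim_col C"
      then have ij: "i < n" "j < n" using C by auto
      have "B\<^sup>T $$ (Suc i, Suc j) = B $$ (Suc j, Suc i)" using B ij by simp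
      then show "C\<^sup>T $$ (i, j) = C $$ (i, j)" using BT ij by (simp add: C_def)
    qed (use C in auto)
    then obtain R g where R: "R \<in> carrier_mat n n" and RR: "R * R\<^sup>T = 1\<^sub>m n"
      and CR: "C = R * mat_diag n g * R\<^sup>T"
      using Suc.IH[OF C] by blast
    define K where "K = four_block_mat (1\<^sub>m 1) (0\<^sub>m 1 n) (0\<^sub>m n 1) R"
    define f where "f i = (case i of 0 \<Rightarrow> l | Suc i \<Rightarrow> g i)" for i
    have K: "K \<in> carrier_mat ?n ?n" using R by (auto simp: K_def)
    have KT: "K\<^sup>T = four_block_mat (1\<^sub>m 1) (0\<^sub>m 1 n) (0\<^sub>m n 1) (R\<^sup>T)"
      unfolding K_def by (subst transpose_four_block_mat[of _ 1 1 _ n _ n]) (use R in auto)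
    have diag: "mat_diag ?n f = four_block_mat (mat 1 1 (\<lambda>_. l)) (0\<^sub>m 1 n) (0\<^sub>m n 1) (mat_diag n g)"
      by (rule eq_matI) (auto simp: mat_diag_def f_def split: nat.splits)
    have KK: "K * K\<^sup>T = 1\<^sub>m ?n"
      unfolding KT unfolding K_def
      by (subst mult_four_block_mat[of _ 1 1 _ n _ n]) (use R RR in auto)
    have "K * mat_diag ?n f = four_block_mat (mat 1 1 (\<lambda>_. l)) (0\<^sub>m 1 n) (0\<^sub>m n 1) (R * mat_diag n g)"
      unfolding K_def diag
      by (subst mult_four_block_mat[of _ 1 1 _ n _ n])
         (use R in \<open>auto simp: left_mult_zero_mat[of _ n n]\<close>)
    then have BK: "K * mat_diag ?n f * K\<^sup>T = B"
      unfolding KT Bblock CR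
      by (simp, subst mult_four_block_mat[of _ 1 1 _ n _ n])
         (use R mult_carrier_mat[OF R mat_diag_dim[of n g]] in
           \<open>auto simp: right_mult_zero_mat[of _ n n] mult_carrier_mat[of _ n n _ n]\<close>)
    have QT: "(H * K)\<^sup>T = K\<^sup>T * H" using transpose_mult[OF H K] HT by simp
    have "(H * K) * (H * K)\<^sup>T = H * ((K * K\<^sup>T) * H)"
      unfolding QT using H K by (simp add: assoc_mult_mat[of _ ?n ?n _ ?n _ ?n] mult_carrier_mat[of _ ?n ?n _ ?n])
    also have "\<dots> = 1\<^sub>m ?n" using KK HH H by simp
    finally have "(H * K) * (H * K)\<^sup>T = 1\<^sub>m ?n" .
    moreover have "H * K * mat_diag ?n f * (H * K)\<^sup>T = H * (K * mat_diag ?n f * K\<^sup>T) * H"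
      unfolding QT using H K by (simp add: assoc_mult_mat[of _ ?n ?n _ ?n _ ?n] mult_carrier_mat[of _ ?n ?n _ ?n])
    moreover have "H * B * H = (H * H) * A * (H * H)"
      unfolding B_def using H A by (simp add: assoc_mult_mat[of _ ?n ?n _ ?n _ ?n] mult_carrier_mat[of _ ?n ?n _ ?n])
    then have "H * B * H = A" unfolding HH using A by simp
    ultimately show ?case using H K BK mult_carrier_mat[OF H K] by metis
  qed
  then show thesis using that by blast
qed

section \<open>Counting eigenvalues with test vectors\<close>

lemma proots_linear_factors:
  "proots (\<Prod>a\<leftarrow>as. [:- a, 1:]) = mset (as :: 'a :: idom list)"
proof (induction as)
  case (Cons a as)
  have "(\<Prod>a\<leftarrow>as. [:- a, 1:]) \<noteq> 0" by (auto simp: prod_list_zero_iff)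
  then have "proots ([:- a, 1:] * (\<Prod>a\<leftarrow>as. [:- a, 1:])) = proots [:- a, 1:] + mset as"
    by (subst proots_mult) (use Cons in auto)
  then show ?case by (simp del: mult_pCons_left)
qed simp

text \<open>
  Padding the system with zero equations gives a singular square matrix.
\<close>

lemma underdetermined_system_nontrivial_solution:
  fixes b :: "nat \<Rightarrow> nat \<Rightarrow> real"
  assumes "r < m"
  obtains c where "\<exists>j<m. c j \<noteq> 0" "\<And>i. i < r \<Longrightarrow> (\<Sum>j<m. b i j * c j) = 0"
proof -
  define M where "M = mat m m (\<lambda>(i, j). if i < r then b i j else 0)"
  have M: "M \<in> carrier_mat m m" by (simp add: M_def)
  let ?e = "unit_vec m r :: real vec"
  have "M\<^sup>T *\<^sub>v ?e = 0\<^sub>v m"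
    using assms by (intro eq_vecI) (auto simp: M_def mult_unit_vec_col)
  moreover have "?e \<noteq> 0\<^sub>v m" using assms by simp
  ultimately have "det (M\<^sup>T) = 0"
    using det_0_iff_vec_prod_zero[of "M\<^sup>T" m] M unit_vec_carrier[of m r]
    by (metis transpose_carrier_mat)
  then have "det M = 0" using det_transpose[OF M] by simp
  then obtain w where w: "w \<in> carrier_vec m" "w \<noteq> 0\<^sub>v m" "M *\<^sub>v w = 0\<^sub>v m"
    using det_0_iff_vec_prod_zero[OF M] by auto
  have "\<exists>j<m. w $ j \<noteq> 0"
    using w by (metis carrier_vecD eq_vecI index_zero_vec)
  moreover have "(\<Sum>j<m. b i j * w $ j) = 0" if "i < r" for i
  proof -
    have "(M *\<^sub>v w) $ i = (\<Sum>j<m. b i j * w $ j)"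
      using w(1) that assms by (auto simp: M_def scalar_prod_def atLeast0LessThan)
    then show ?thesis using w that assms by simp
  qed
  ultimately show thesis using that by blast
qed

text \<open>
  The easy half of the Courant-Fischer principle, counted with multiplicity. If fewer than \<open>m\<close>
  eigenvalues were below \<open>t\<close>, some nontrivial combination of the \<open>m\<close> test vectors would be orthogonal
  to all eigenvectors for these eigenvalues, and on such a vector the quadratic form is at least \<open>t\<close>
  times the squared norm. Linear independence of the test vectors is part of the strict inequality,
  which fails for the zero vector.
\<close>

lemma size_filter_eigenvalues_add_le:
  fixes A :: "real mat" and x :: "nat \<Rightarrow> nat \<Rightarrow> real"
  assumes A: "A \<in> carrier_mat n n" and sym: "A\<^sup>T = A"
    and form: "\<And>c. \<exists>j<m. c j \<noteq> 0 \<Longrightarrow>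
      (let y = vec n (\<lambda>i. \<Sum>j<m. c j * x j i) in y \<bullet> (A *\<^sub>v y) < t * (y \<bullet> y))"
  shows "size (filter_mset (\<lambda>l. t \<le> l) (proots (char_poly A))) + m \<le> n"
proof -
  obtain Q f where Q: "Q \<in> carrier_mat n n" and QQ: "Q * Q\<^sup>T = 1\<^sub>m n"
    and AQ: "A = Q * mat_diag n f * Q\<^sup>T"
    using symmetric_mat_diagonalization[OF A sym] by blast
  have QQ': "Q\<^sup>T * Q = 1\<^sub>m n"
    using mat_mult_left_right_inverse[OF Q _ QQ] Q by simp
  let ?D = "mat_diag n f"
  have "similar_mat A ?D"
    by (rule similar_matI[of _ _ Q "Q\<^sup>T" n]) (use A Q QQ QQ' AQ in auto)
  then have "char_poly A = char_poly ?D" by (rule char_poly_similar)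
  also have "\<dots> = (\<Prod>a\<leftarrow>diag_mat ?D. [:- a, 1:])"
    by (rule char_poly_upper_triangular[of _ n]) (auto simp: mat_diag_def)
  also have "diag_mat ?D = map f [0..<n]"
    by (auto simp: diag_mat_def mat_diag_def)
  finally have "proots (char_poly A) = mset (map f [0..<n])"
    by (simp only: proots_linear_factors)
  then have "size (filter_mset (\<lambda>l. t \<le> l) (proots (char_poly A)))
      = length (filter (\<lambda>l. t \<le> l) (map f [0..<n]))"
    by (metis mset_filter size_mset)
  also have "\<dots> = length (filter (\<lambda>i. t \<le> f i) [0..<n])"
    by (simp add: filter_map o_def)
  also have "\<dots> = card {i. i < n \<and> t \<le> f i}"
    by (simp add: length_filter_conv_card) (metis (no_types, lifting) nth_upt add_0)
  finally have count: "size (filter_mset (\<lambda>l. t \<le> l) (proots (char_poly A)))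
      = card {i. i < n \<and> t \<le> f i}" .
  define J where "J = {i. i < n \<and> f i < t}"
  have "{i. i < n \<and> t \<le> f i} \<union> J = {..<n}" "{i. i < n \<and> t \<le> f i} \<inter> J = {}"
    by (auto simp: J_def)
  then have cards: "card {i. i < n \<and> t \<le> f i} + card J = n"
    by (metis card_Un_disjoint card_lessThan finite_Un finite_lessThan)
  have "m \<le> card J"
  proof (rule ccontr)
    assume "\<not> m \<le> card J"
    then have less: "card J < m" by simp
    have "finite J" by (simp add: J_def)
    then obtain e where e: "bij_betw e {0..<card J} J" using ex_bij_betw_nat_finite by blast
    \<comment> \<open>Orthogonality of a combination to the eigenvectors indexed by \<open>J\<close> is a homogeneous system
       with fewer equations than unknowns.\<close>
    define b where "b i j = (\<Sum>k<n. Q $$ (k, e i) * x j k)" for i j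
    obtain c where c: "\<exists>j<m. c j \<noteq> 0" and cb: "\<And>i. i < card J \<Longrightarrow> (\<Sum>j<m. b i j * c j) = 0"
      using underdetermined_system_nontrivial_solution[OF less] by metis
    define y where "y = vec n (\<lambda>i. \<Sum>j<m. c j * x j i)"
    have y: "y \<in> carrier_vec n" by (simp add: y_def)
    define z where "z = Q\<^sup>T *\<^sub>v y"
    have z: "z \<in> carrier_vec n"
      unfolding z_def by (rule mult_mat_vec_carrier[OF _ y]) (use Q in simp)
    have zJ: "z $ i = 0" if "i \<in> J" for i
    proof -
      have "i \<in> e ` {0..<card J}" using e that by (simp add: bij_betw_def)
      then obtain r where r: "r < card J" "e r = i" by auto
      have i: "i < n" using that by (simp add: J_def)
      have "z $ i = (\<Sum>k<n. Q $$ (k, i) * (\<Sum>j<m. c j * x j k))"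
        using Q i by (auto simp: z_def y_def scalar_prod_def atLeast0LessThan)
      also have "\<dots> = (\<Sum>j<m. b r j * c j)"
        unfolding b_def r(2) sum_distrib_left sum_distrib_right
        by (subst sum.swap) (simp add: mult_ac)
      also have "\<dots> = 0" using cb r by simp
      finally show ?thesis .
    qed
    have yz: "Q *\<^sub>v z = y"
      unfolding z_def using Q y QQ by (metis assoc_mult_mat_vec one_mult_mat_vec transpose_carrier_mat)
    have zz: "z \<bullet> z = y \<bullet> y"
      using transpose_vec_mult_scalar[OF Q z y] yz by (simp add: z_def)
    have "A *\<^sub>v y = Q *\<^sub>v (?D *\<^sub>v z)"
      unfolding AQ z_def using Q y transpose_carrier_mat[of Q n n]
      by (simp add: assoc_mult_mat_vec[of _ n n _ n] mult_mat_vec_carrier[of "Q\<^sup>T" n n])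
    then have "y \<bullet> (A *\<^sub>v y) = z \<bullet> (?D *\<^sub>v z)"
      using transpose_vec_mult_scalar[OF Q _ y, of "?D *\<^sub>v z"] z
      by (metis z_def mat_diag_dim mult_mat_vec_carrier)
    also have "\<dots> = (\<Sum>i<n. f i * (z $ i * z $ i))"
      using z by (auto simp: mat_diag_def scalar_prod_def atLeast0LessThan if_distrib
          if_distribR sum.delta cong: if_cong intro!: sum.cong)
    also have "\<dots> \<ge> (\<Sum>i<n. t * (z $ i * z $ i))"
    proof (rule sum_mono)
      fix i assume "i \<in> {..<n}"
      then show "t * (z $ i * z $ i) \<le> f i * (z $ i * z $ i)"
        using zJ[of i] by (cases "i \<in> J") (auto simp: J_def intro!: mult_right_mono)
    qed
    also have "(\<Sum>i<n. t * (z $ i * z $ i)) = t * (z \<bullet> z)"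
      using z by (simp add: scalar_prod_def atLeast0LessThan sum_distrib_left)
    finally have "t * (y \<bullet> y) \<le> y \<bullet> (A *\<^sub>v y)" unfolding zz .
    then show False using form[OF c] by (simp add: y_def Let_def)
  qed
  then show ?thesis using count cards by linarith
qed

section \<open>The Laplacian quadratic form\<close>

text \<open>
  The Laplacian quadratic form of the subgraph induced on \<open>S\<close>: every edge is met as two arcs, whence
  the factor one half.
\<close>

definition dirichlet :: "('a, 'b) pre_digraph \<Rightarrow> 'a set \<Rightarrow> ('a \<Rightarrow> real) \<Rightarrow> real" where
  "dirichlet G S x = (\<Sum>u\<in>S. \<Sum>v\<in>S. if u \<rightarrow>\<^bsub>G\<^esub> v then (x u - x v)\<^sup>2 else 0) / 2"

lemma (in graph) out_degree_eq_card_neighbours: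
  "out_degree G u = card {v \<in> verts G. u \<rightarrow>\<^bsub>G\<^esub> v}"
proof -
  have "bij_betw (head G) (out_arcs G u) {v \<in> verts G. u \<rightarrow>\<^bsub>G\<^esub> v}"
  proof (rule bij_betwI')
    fix a b assume "a \<in> out_arcs G u" "b \<in> out_arcs G u"
    then show "(head G a = head G b) = (a = b)"
      using no_multi_arcs by (auto simp: out_arcs_def arc_to_ends_def)
  qed (auto simp: out_arcs_def arcs_ends_def arc_to_ends_def)
  then show ?thesis unfolding out_degree_def by (rule bij_betw_same_card)
qed

lemma (in graph) adj_sym: "u \<rightarrow>\<^bsub>G\<^esub> v \<longleftrightarrow> v \<rightarrow>\<^bsub>G\<^esub> u"
  using sym_arcs unfolding symmetric_def by (auto dest: symD)

lemma (in graph) dirichlet_verts: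
  "dirichlet G (verts G) x = (\<Sum>u\<in>verts G. real (out_degree G u) * (x u)\<^sup>2)
     - (\<Sum>u\<in>verts G. \<Sum>v\<in>verts G. if u \<rightarrow>\<^bsub>G\<^esub> v then x u * x v else 0)"
proof -
  let ?V = "verts G"
  have deg: "(\<Sum>v\<in>?V. if u \<rightarrow>\<^bsub>G\<^esub> v then (x u)\<^sup>2 else 0) = real (out_degree G u) * (x u)\<^sup>2" for u
    unfolding out_degree_eq_card_neighbours
    by (simp add: sum.If_cases Collect_conj_eq)
  have "(\<Sum>u\<in>?V. \<Sum>v\<in>?V. if u \<rightarrow>\<^bsub>G\<^esub> v then (x v)\<^sup>2 else 0)
      = (\<Sum>v\<in>?V. \<Sum>u\<in>?V. if v \<rightarrow>\<^bsub>G\<^esub> u then (x v)\<^sup>2 else 0)"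
    by (subst sum.swap) (simp add: adj_sym)
  then have deg': "(\<Sum>u\<in>?V. \<Sum>v\<in>?V. if u \<rightarrow>\<^bsub>G\<^esub> v then (x v)\<^sup>2 else 0)
      = (\<Sum>u\<in>?V. real (out_degree G u) * (x u)\<^sup>2)"
    by (simp add: deg)
  have "(\<Sum>u\<in>?V. \<Sum>v\<in>?V. if u \<rightarrow>\<^bsub>G\<^esub> v then (x u - x v)\<^sup>2 else 0)
      = (\<Sum>u\<in>?V. \<Sum>v\<in>?V. (if u \<rightarrow>\<^bsub>G\<^esub> v then (x u)\<^sup>2 else 0) + (if u \<rightarrow>\<^bsub>G\<^esub> v then (x v)\<^sup>2 else 0)
          - 2 * (if u \<rightarrow>\<^bsub>G\<^esub> v then x u * x v else 0))"
    by (intro sum.cong) (auto simp: power2_diff)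
  also have "\<dots> = 2 * (\<Sum>u\<in>?V. real (out_degree G u) * (x u)\<^sup>2)
     - 2 * (\<Sum>u\<in>?V. \<Sum>v\<in>?V. if u \<rightarrow>\<^bsub>G\<^esub> v then x u * x v else 0)"
    unfolding sum_subtractf sum.distrib deg deg' sum_distrib_left[symmetric] by simp
  finally show ?thesis by (simp add: dirichlet_def)
qed

lemma (in graph) laplacian_count_add_le:
  fixes x :: "nat \<Rightarrow> 'a \<Rightarrow> real"
  assumes form: "\<And>c. \<exists>j<m. c j \<noteq> 0 \<Longrightarrow>
      (let y = \<lambda>v. \<Sum>j<m. c j * x j v
       in dirichlet G (verts G) y < t * (\<Sum>v\<in>verts G. (y v)\<^sup>2))"
  shows "laplacian_count G {t..b} + m \<le> card (verts G)"
proof -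
  obtain vs where vs: "distinct vs" "set vs = verts G"
    using finite_distinct_list[OF finite_verts] by blast
  define n where "n = length vs"
  have n: "card (verts G) = n" using vs distinct_card[of vs] by (simp add: n_def)
  let ?A = "laplacian_mat G vs"
  have A: "?A \<in> carrier_mat n n"
    by (auto simp: laplacian_mat_def degree_mat_def adjacency_mat_def n_def)
  have sym: "?A\<^sup>T = ?A"
    by (rule eq_matI) (auto simp: laplacian_mat_def degree_mat_def adjacency_mat_def adj_sym)
  have reindex: "(\<Sum>i<n. h (vs ! i)) = (\<Sum>v\<in>verts G. h v)" for h :: "'a \<Rightarrow> real"
    using sum.reindex_bij_betw[OF bij_betw_nth[OF vs(1) _ vs(2)[symmetric]], of "{..<n}" h]
    by (simp add: n_def)
  have quad: "vec n (\<lambda>i. y (vs ! i)) \<bullet> (?A *\<^sub>v vec n (\<lambda>i. y (vs ! i))) = dirichlet G (verts G) y"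
    for y :: "'a \<Rightarrow> real"
  proof -
    have "vec n (\<lambda>i. y (vs ! i)) \<bullet> (?A *\<^sub>v vec n (\<lambda>i. y (vs ! i)))
        = (\<Sum>i<n. y (vs ! i) * (\<Sum>k<n. ?A $$ (i, k) * y (vs ! k)))"
      using A by (auto simp: scalar_prod_def atLeast0LessThan intro!: sum.cong)
    also have "\<dots> = (\<Sum>i<n. real (out_degree G (vs ! i)) * (y (vs ! i))\<^sup>2
        - (\<Sum>k<n. if vs ! i \<rightarrow>\<^bsub>G\<^esub> vs ! k then y (vs ! i) * y (vs ! k) else 0))"
    proof (rule sum.cong)
      fix i assume "i \<in> {..<n}"
      then have i: "i < n" by simp
      have "(\<Sum>k<n. ?A $$ (i, k) * y (vs ! k))
          = (\<Sum>k<n. (if i = k then real (out_degree G (vs ! i)) * y (vs ! i) else 0)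
              - (if vs ! i \<rightarrow>\<^bsub>G\<^esub> vs ! k then y (vs ! k) else 0))"
        using i by (intro sum.cong)
          (auto simp: laplacian_mat_def degree_mat_def adjacency_mat_def n_def algebra_simps)
      also have "\<dots> = real (out_degree G (vs ! i)) * y (vs ! i)
          - (\<Sum>k<n. if vs ! i \<rightarrow>\<^bsub>G\<^esub> vs ! k then y (vs ! k) else 0)"
        using i by (simp add: sum_subtractf)
      finally have "y (vs ! i) * (\<Sum>k<n. ?A $$ (i, k) * y (vs ! k))
          = real (out_degree G (vs ! i)) * (y (vs ! i))\<^sup>2
            - y (vs ! i) * (\<Sum>k<n. if vs ! i \<rightarrow>\<^bsub>G\<^esub> vs ! k then y (vs ! k) else 0)"
        by (simp only: right_diff_distrib power2_eq_square mult_ac)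
      also have "y (vs ! i) * (\<Sum>k<n. if vs ! i \<rightarrow>\<^bsub>G\<^esub> vs ! k then y (vs ! k) else 0)
          = (\<Sum>k<n. if vs ! i \<rightarrow>\<^bsub>G\<^esub> vs ! k then y (vs ! i) * y (vs ! k) else 0)"
        unfolding sum_distrib_left by (intro sum.cong) auto
      finally show "y (vs ! i) * (\<Sum>k<n. ?A $$ (i, k) * y (vs ! k))
        = real (out_degree G (vs ! i)) * (y (vs ! i))\<^sup>2
          - (\<Sum>k<n. if vs ! i \<rightarrow>\<^bsub>G\<^esub> vs ! k then y (vs ! i) * y (vs ! k) else 0)" .
    qed simp
    also have "\<dots> = dirichlet G (verts G) y"
      unfolding dirichlet_verts reindex sum_subtractf[symmetric]
      using reindex[of "\<lambda>u. real (out_degree G u) * (y u)\<^sup>2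
        - (\<Sum>v\<in>verts G. if u \<rightarrow>\<^bsub>G\<^esub> v then y u * y v else 0)"]
        reindex[of "\<lambda>v. if u \<rightarrow>\<^bsub>G\<^esub> v then y u * y v else 0" for u]
      by simp
    finally show ?thesis .
  qed
  have norm: "vec n (\<lambda>i. y (vs ! i)) \<bullet> vec n (\<lambda>i. y (vs ! i)) = (\<Sum>v\<in>verts G. (y v)\<^sup>2)"
    for y :: "'a \<Rightarrow> real"
    unfolding reindex[symmetric] by (simp add: scalar_prod_def atLeast0LessThan power2_eq_square)
  have "size (filter_mset (\<lambda>l. t \<le> l) (proots (char_poly ?A))) + m \<le> n"
  proof (rule size_filter_eigenvalues_add_le[OF A sym, where x = "\<lambda>j i. x j (vs ! i)"])
    fix c :: "nat \<Rightarrow> real"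
    assume "\<exists>j<m. c j \<noteq> 0"
    from form[OF this]
    show "let y = vec n (\<lambda>i. \<Sum>j<m. c j * x j (vs ! i)) in y \<bullet> (?A *\<^sub>v y) < t * (y \<bullet> y)"
      unfolding Let_def
      using quad[of "\<lambda>v. \<Sum>j<m. c j * x j v"] norm[of "\<lambda>v. \<Sum>j<m. c j * x j v"] by simp
  qed
  moreover have "laplacian_count G {t..b} \<le> size (filter_mset (\<lambda>l. t \<le> l) (proots (char_poly ?A)))"
    unfolding laplacian_count_def laplacian_eigenvalues_eq[OF vs]
    by (intro size_mset_mono filter_mset_mono_strong) auto
  ultimately show ?thesis using n by simp
qed

text \<open>
  This is interlacing for the complement graph, phrased with test functions. It passes from an
  induced subgraph to the whole graph at the cost of adding the number of missing vertices to the
  threshold. The function on \<open>S\<close> is extended by its mean value \<open>\<mu>\<close>. Each missing vertex is joined to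
  each vertex \<open>u\<close> of \<open>S\<close> at most once and so contributes at most \<open>(x u - \<mu>)\<^sup>2\<close>; summed over \<open>S\<close> these
  deviations are at most the squared norm of \<open>x\<close>. Since the mean depends linearly on
  \<open>x\<close>, spaces of test functions extend to spaces of the same dimension.
\<close>

lemma (in graph) dirichlet_mean_extension:
  assumes S: "S \<subseteq> verts G" "S \<noteq> {}" and s: "0 \<le> s"
    and less: "dirichlet G S x < s * (\<Sum>v\<in>S. (x v)\<^sup>2)"
    and y: "\<And>v. y v = (if v \<in> S then x v else (\<Sum>v\<in>S. x v) / real (card S))"
  shows "dirichlet G (verts G) y
    < (s + real (card (verts G)) - real (card S)) * (\<Sum>v\<in>verts G. (y v)\<^sup>2)"
proof -
  let ?V = "verts G"
  define T where "T = ?V - S"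
  define k where "k = real (card S)"
  define r where "r = real (card T)"
  define \<mu> where "\<mu> = (\<Sum>v\<in>S. x v) / k"
  define X where "X = (\<Sum>v\<in>S. (x v)\<^sup>2)"
  have fin: "finite S" "finite T" using S finite_subset[OF _ finite_verts] by (auto simp: T_def)
  have V: "?V = S \<union> T" "S \<inter> T = {}" using S by (auto simp: T_def)
  have k: "k > 0" using S fin by (auto simp: k_def card_gt_0_iff)
  have n: "real (card ?V) = k + r"
    unfolding V(1) k_def r_def using card_Un_disjoint[OF fin V(2)] by simp
  have yS: "y v = x v" if "v \<in> S" for v using that y by simp
  have yT: "y v = \<mu>" if "v \<in> T" for v using that y by (simp add: T_def \<mu>_def k_def)
  let ?q = "\<lambda>u v. if u \<rightarrow>\<^bsub>G\<^esub> v then (y u - y v)\<^sup>2 else 0"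
  have SS: "(\<Sum>u\<in>S. \<Sum>v\<in>S. ?q u v) = 2 * dirichlet G S x"
    by (simp add: dirichlet_def yS cong: if_cong)
  have TT: "(\<Sum>u\<in>T. \<Sum>v\<in>T. ?q u v) = 0"
    by (simp add: yT)
  have TS: "(\<Sum>u\<in>T. \<Sum>v\<in>S. ?q u v) = (\<Sum>u\<in>S. \<Sum>v\<in>T. ?q u v)"
    by (subst sum.swap, intro sum.cong refl) (auto simp: adj_sym power2_commute)
  have "(\<Sum>u\<in>S. \<Sum>v\<in>T. ?q u v) \<le> (\<Sum>u\<in>S. \<Sum>v\<in>T. (x u - \<mu>)\<^sup>2)"
    by (intro sum_mono) (auto simp: yS yT)
  also have "\<dots> = r * (\<Sum>u\<in>S. (x u - \<mu>)\<^sup>2)"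
    by (simp add: r_def sum_distrib_left)
  also have "(\<Sum>u\<in>S. (x u - \<mu>)\<^sup>2) = (\<Sum>u\<in>S. (x u)\<^sup>2 - 2 * \<mu> * x u + \<mu>\<^sup>2)"
    by (intro sum.cong) (auto simp: power2_diff)
  also have "\<dots> = X - 2 * \<mu> * (\<Sum>u\<in>S. x u) + k * \<mu>\<^sup>2"
    by (simp add: sum.distrib sum_subtractf sum_distrib_left X_def k_def)
  also have "\<dots> = X - k * \<mu>\<^sup>2"
  proof -
    have "(\<Sum>u\<in>S. x u) = k * \<mu>" using k by (simp add: \<mu>_def)
    then show ?thesis by (simp add: power2_eq_square)
  qed
  finally have ST: "(\<Sum>u\<in>S. \<Sum>v\<in>T. ?q u v) \<le> r * (X - k * \<mu>\<^sup>2)" .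
  have "2 * dirichlet G ?V y = (\<Sum>u\<in>S. \<Sum>v\<in>S. ?q u v) + (\<Sum>u\<in>S. \<Sum>v\<in>T. ?q u v)
      + ((\<Sum>u\<in>T. \<Sum>v\<in>S. ?q u v) + (\<Sum>u\<in>T. \<Sum>v\<in>T. ?q u v))"
    unfolding dirichlet_def V(1)
    by (simp add: sum.union_disjoint[OF fin V(2)] sum.distrib)
  then have "dirichlet G ?V y \<le> dirichlet G S x + r * (X - k * \<mu>\<^sup>2)"
    using SS TT TS ST by linarith
  also have "\<dots> < s * X + r * (X - k * \<mu>\<^sup>2)" using less by (simp add: X_def)
  also have "\<dots> \<le> (s + r) * (X + r * \<mu>\<^sup>2)"
  proof -
    have "0 \<le> (s + r) * (r * \<mu>\<^sup>2) + r * (k * \<mu>\<^sup>2)" using s k by (simp add: r_def)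
    then show ?thesis by (simp add: algebra_simps)
  qed
  also have "X + r * \<mu>\<^sup>2 = (\<Sum>v\<in>?V. (y v)\<^sup>2)"
    unfolding V(1) by (simp add: sum.union_disjoint[OF fin V(2)] yS yT X_def r_def)
  finally show ?thesis using n by (simp add: k_def)
qed

section \<open>Test functions that are constant on layers\<close>

text \<open>
  Suppose that the vertices lie in layers \<open>0, \<dots>, d\<close> of sizes \<open>N i\<close> and that edges stay within a layer
  or join consecutive layers. For a function that takes the value \<open>g i\<close> on layer \<open>i\<close>, the energy is the
  value of the Laplacian form when consecutive layers are completely joined, which is the worst case,
  and the mass is the squared norm.
\<close>

definition layer_energy :: "nat \<Rightarrow> (nat \<Rightarrow> nat) \<Rightarrow> (nat \<Rightarrow> real) \<Rightarrow> real" where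
  "layer_energy d N g = (\<Sum>i<d. real (N i) * real (N (Suc i)) * (g i - g (Suc i))\<^sup>2)"

definition layer_mass :: "nat \<Rightarrow> (nat \<Rightarrow> nat) \<Rightarrow> (nat \<Rightarrow> real) \<Rightarrow> real" where
  "layer_mass d N g = (\<Sum>i\<le>d. real (N i) * (g i)\<^sup>2)"

text \<open>
  A labelling \<open>B\<close> groups the layers into \<open>m\<close> blocks. The label of a layer selects the coefficient
  that the function takes there, and layers with a label \<open>\<ge> m\<close> get the value \<open>0\<close>.
\<close>

definition block_function :: "nat \<Rightarrow> (nat \<Rightarrow> nat) \<Rightarrow> (nat \<Rightarrow> real) \<Rightarrow> nat \<Rightarrow> real" where
  "block_function m B c i = (if B i < m then c (B i) else 0)"

text \<open>
  The energy is below \<open>s\<close> times the mass on the whole \<open>m\<close>-dimensional space of functions constant on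
  the blocks.
\<close>

definition negative_blocks :: "nat \<Rightarrow> nat \<Rightarrow> nat \<Rightarrow> (nat \<Rightarrow> nat) \<Rightarrow> (nat \<Rightarrow> nat) \<Rightarrow> bool" where
  "negative_blocks m s d N B \<longleftrightarrow> (\<forall>c. (\<exists>j<m. c j \<noteq> 0) \<longrightarrow>
     layer_energy d N (block_function m B c) < real s * layer_mass d N (block_function m B c))"

lemma sum_over_layers:
  fixes h :: "nat \<Rightarrow> real"
  assumes "finite S" "\<And>v. v \<in> S \<Longrightarrow> l v \<le> d"
  shows "(\<Sum>v\<in>S. h (l v)) = (\<Sum>i\<le>d. real (card {v \<in> S. l v = i}) * h i)"
proof -
  have "(\<Sum>v\<in>S. h (l v)) = (\<Sum>v\<in>S. \<Sum>i\<le>d. if l v = i then h i else 0)"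
    using assms by (intro sum.cong) auto
  also have "\<dots> = (\<Sum>i\<le>d. \<Sum>v\<in>S. if l v = i then h i else 0)" by (rule sum.swap)
  also have "\<dots> = (\<Sum>i\<le>d. real (card {v \<in> S. l v = i}) * h i)"
    using assms by (simp add: sum.If_cases Int_def)
  finally show ?thesis .
qed

text \<open>
  Only edges between consecutive layers contribute, and there are at most \<open>N i * N (Suc i)\<close> of them
  above layer \<open>i\<close>.
\<close>

lemma (in graph) dirichlet_layer_function_le:
  assumes S: "finite S" and l: "\<And>v. v \<in> S \<Longrightarrow> l v \<le> d"
    and lip: "\<And>u v. u \<in> S \<Longrightarrow> v \<in> S \<Longrightarrow> u \<rightarrow>\<^bsub>G\<^esub> v \<Longrightarrow> l v \<le> Suc (l u)"
  shows "dirichlet G S (\<lambda>v. g (l v)) \<le> layer_energy d (\<lambda>i. card {v \<in> S. l v = i}) g"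
proof -
  let ?N = "\<lambda>i. card {v \<in> S. l v = i}"
  let ?p = "\<lambda>u v. \<Sum>i<d. if l u = i \<and> l v = Suc i then (g i - g (Suc i))\<^sup>2 else 0"
  have up: "?p u v = (if l v = Suc (l u) then (g (l u) - g (l v))\<^sup>2 else 0)"
    if "u \<in> S" "v \<in> S" for u v
  proof -
    have "?p u v = (\<Sum>i<d. if i = l u then (if l v = Suc (l u) then (g (l u) - g (l v))\<^sup>2 else 0) else 0)"
      by (intro sum.cong) auto
    then show ?thesis using l[OF that(2)] by auto
  qed
  have "(\<Sum>u\<in>S. \<Sum>v\<in>S. if u \<rightarrow>\<^bsub>G\<^esub> v then (g (l u) - g (l v))\<^sup>2 else 0)
      \<le> (\<Sum>u\<in>S. \<Sum>v\<in>S. ?p u v + ?p v u)"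
  proof (intro sum_mono)
    fix u v assume uv: "u \<in> S" "v \<in> S"
    have pos: "0 \<le> ?p u v" "0 \<le> ?p v u" by (auto intro!: sum_nonneg)
    show "(if u \<rightarrow>\<^bsub>G\<^esub> v then (g (l u) - g (l v))\<^sup>2 else 0) \<le> ?p u v + ?p v u"
    proof (cases "u \<rightarrow>\<^bsub>G\<^esub> v")
      case True
      then have "l v \<le> Suc (l u)" "l u \<le> Suc (l v)" using lip uv adj_sym by blast+
      then consider "l v = l u" | "l v = Suc (l u)" | "l u = Suc (l v)" by linarith
      then show ?thesis
        using True pos unfolding up[OF uv] up[OF uv(2,1)]
        by cases (auto simp: power2_commute)
    qed (use pos in simp)
  qed
  also have "\<dots> = 2 * (\<Sum>u\<in>S. \<Sum>v\<in>S. ?p u v)"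
    unfolding sum.distrib by (subst (2) sum.swap) simp
  also have "(\<Sum>u\<in>S. \<Sum>v\<in>S. ?p u v)
      = (\<Sum>u\<in>S. \<Sum>i<d. \<Sum>v\<in>S. if l u = i \<and> l v = Suc i then (g i - g (Suc i))\<^sup>2 else 0)"
    by (intro sum.cong[OF refl] sum.swap)
  also have "\<dots> = (\<Sum>i<d. \<Sum>u\<in>S. \<Sum>v\<in>S. if l u = i \<and> l v = Suc i then (g i - g (Suc i))\<^sup>2 else 0)"
    by (rule sum.swap)
  also have "\<dots> = layer_energy d ?N g"
    unfolding layer_energy_def
  proof (rule sum.cong[OF refl])
    fix i
    have "(\<Sum>u\<in>S. \<Sum>v\<in>S. if l u = i \<and> l v = Suc i then (g i - g (Suc i))\<^sup>2 else 0)
        = (\<Sum>u\<in>S. if l u = i then (\<Sum>v\<in>S. if l v = Suc i then (g i - g (Suc i))\<^sup>2 else 0) else 0)"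
      by (intro sum.cong) auto
    then show "(\<Sum>u\<in>S. \<Sum>v\<in>S. if l u = i \<and> l v = Suc i then (g i - g (Suc i))\<^sup>2 else 0)
        = real (?N i) * real (?N (Suc i)) * (g i - g (Suc i))\<^sup>2"
      using S by (simp add: sum.If_cases Int_def)
  qed
  finally show ?thesis by (simp add: dirichlet_def)
qed

text \<open>
  The bridge from the graph to the layer sizes: the indicator functions of the blocks, extended by
  their means, are the test vectors.
\<close>

lemma (in graph) laplacian_count_layers:
  assumes S: "S \<subseteq> verts G" "S \<noteq> {}" and l: "\<And>v. v \<in> S \<Longrightarrow> l v \<le> d"
    and lip: "\<And>u v. u \<in> S \<Longrightarrow> v \<in> S \<Longrightarrow> u \<rightarrow>\<^bsub>G\<^esub> v \<Longrightarrow> l v \<le> Suc (l u)"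
    and B: "negative_blocks m s d (\<lambda>i. card {v \<in> S. l v = i}) B"
  shows "laplacian_count G {real s + real (card (verts G)) - real (card S)..b} + m \<le> card (verts G)"
proof -
  have fin: "finite S" using S finite_subset finite_verts by blast
  define e where "e j v = (if B (l v) = j then 1 else 0 :: real)" for j v
  define x where "x j v = (if v \<in> S then e j v else (\<Sum>u\<in>S. e j u) / real (card S))" for j v
  have combo: "(\<Sum>j<m. c j * e j v) = block_function m B c (l v)" for c v
  proof -
    have "(\<Sum>j<m. c j * e j v) = (\<Sum>j<m. if j = B (l v) then c (B (l v)) else 0)"
      by (intro sum.cong) (auto simp: e_def)
    then show ?thesis by (simp add: block_function_def)
  qed
  show ?thesis
  proof (rule laplacian_count_add_le[where x = x])
    fix c :: "nat \<Rightarrow> real"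
    assume c: "\<exists>j<m. c j \<noteq> 0"
    let ?g = "block_function m B c"
    let ?y = "\<lambda>v. \<Sum>j<m. c j * x j v"
    have y: "?y v = (if v \<in> S then ?g (l v) else (\<Sum>v\<in>S. ?g (l v)) / real (card S))" for v
    proof (cases "v \<in> S")
      case True
      then show ?thesis using combo[of c v] by (simp add: x_def)
    next
      case False
      then have "?y v = (\<Sum>j<m. \<Sum>u\<in>S. c j * e j u) / real (card S)"
        by (simp add: x_def sum_distrib_left sum_divide_distrib)
      also have "(\<Sum>j<m. \<Sum>u\<in>S. c j * e j u) = (\<Sum>u\<in>S. ?g (l u))"
        by (subst sum.swap) (simp add: combo)
      finally show ?thesis using False by simp
    qed
    have "dirichlet G S (\<lambda>v. ?g (l v)) \<le> layer_energy d (\<lambda>i. card {v \<in> S. l v = i}) ?g"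
      by (rule dirichlet_layer_function_le[OF fin l lip])
    also have "\<dots> < real s * layer_mass d (\<lambda>i. card {v \<in> S. l v = i}) ?g"
      using B c unfolding negative_blocks_def by blast
    also have "layer_mass d (\<lambda>i. card {v \<in> S. l v = i}) ?g = (\<Sum>v\<in>S. (?g (l v))\<^sup>2)"
      unfolding layer_mass_def using sum_over_layers[OF fin l, where h = "\<lambda>i. (?g i)\<^sup>2"] by simp
    finally show "let y = ?y in dirichlet G (verts G) y
        < (real s + real (card (verts G)) - real (card S)) * (\<Sum>v\<in>verts G. (y v)\<^sup>2)"
      unfolding Let_def by (intro dirichlet_mean_extension[OF S _ _ y]) auto
  qed
qed

section \<open>Blocks of layers with small energy\<close>

lemma layer_mass_ge_subset:
  assumes "F \<subseteq> {..d}"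
  shows "(\<Sum>i\<in>F. real (N i) * (g i)\<^sup>2) \<le> layer_mass d N g"
  unfolding layer_mass_def using assms by (intro sum_mono2) auto

text \<open>
  An edge from a singleton layer with value \<open>0\<close> to the neighbouring layer contributes at most the mass
  of that layer. So each pair of consecutive layers contributes at most its own mass, and a layer
  belongs to two pairs unless it is the first or the last one.
\<close>

lemma layer_energy_le_twice_mass:
  assumes cut: "\<And>i. i < d \<Longrightarrow>
      g i = g (Suc i) \<or> (g i = 0 \<and> N i \<le> 1) \<or> (g (Suc i) = 0 \<and> N (Suc i) \<le> 1)"
  shows "layer_energy d N g + real (N 0) * (g 0)\<^sup>2 + real (N d) * (g d)\<^sup>2 \<le> 2 * layer_mass d N g"
proof -
  define h where "h i = real (N i) * (g i)\<^sup>2" for i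
  have "real (N i) * real (N (Suc i)) * (g i - g (Suc i))\<^sup>2 \<le> h i + h (Suc i)" if i: "i < d" for i
  proof -
    consider "g i = g (Suc i)" | "g i = 0" "N i \<le> 1" | "g (Suc i) = 0" "N (Suc i) \<le> 1"
      using cut[OF i] by blast
    then show ?thesis
    proof cases
      case 1
      then show ?thesis by (simp add: h_def)
    next
      case 2
      then show ?thesis by (cases "N i") (auto simp: h_def)
    next
      case 3
      then show ?thesis by (cases "N (Suc i)") (auto simp: h_def)
    qed
  qed
  then have "layer_energy d N g \<le> (\<Sum>i<d. h i + h (Suc i))"
    unfolding layer_energy_def by (intro sum_mono) auto
  also have "\<dots> = (\<Sum>i<d. h i) + (\<Sum>i<d. h (Suc i))" by (simp add: sum.distrib)
  also have "(\<Sum>i<d. h i) = (\<Sum>i\<le>d. h i) - h d"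
    by (simp add: lessThan_Suc_atMost[symmetric])
  also have "(\<Sum>i<d. h (Suc i)) = (\<Sum>i\<le>d. h i) - h 0"
    using sum.atMost_shift[of h d] by simp
  finally show ?thesis by (simp add: layer_mass_def h_def)
qed

text \<open>
  The two sides of a cut layer. The middle layer is also allowed to be empty, which covers two
  vertices at distance \<open>2\<close> taken on their own.
\<close>

lemma negative_blocks_cut_layer:
  assumes c: "0 < c" "c < d" and N: "N 0 = 1" "N d = 1" "N c \<le> 1"
  shows "negative_blocks 2 2 d N (\<lambda>i. if i < c then 0 else if i = c then 2 else 1)"
    (is "negative_blocks _ _ _ _ ?B")
  unfolding negative_blocks_def
proof (intro allI impI)
  fix a :: "nat \<Rightarrow> real"
  assume nz: "\<exists>j<2. a j \<noteq> 0"
  let ?g = "block_function 2 ?B a"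
  have "layer_energy d N ?g + real (N 0) * (?g 0)\<^sup>2 + real (N d) * (?g d)\<^sup>2 \<le> 2 * layer_mass d N ?g"
    by (rule layer_energy_le_twice_mass) (use c N in \<open>auto simp: block_function_def\<close>)
  moreover have "?g 0 = a 0" "?g d = a 1" using c by (auto simp: block_function_def)
  moreover have "(a 0)\<^sup>2 + (a 1)\<^sup>2 > 0"
    using nz by (auto simp: less_2_cases_iff sum_power2_gt_zero_iff)
  ultimately show "layer_energy d N ?g < real 2 * layer_mass d N ?g" using N by simp
qed

text \<open>
  If the cut layer is not next to an end, each side contains a further layer beyond the one adjacent to
  the cut, so its mass strictly exceeds the number of its edges to the cut vertex. This is why the
  threshold drops to \<open>1\<close>.
\<close>

lemma negative_blocks_deep_cut_layer:
  assumes c: "2 \<le> c" "c + 2 \<le> d" and N: "N 0 = 1" "N d = 1" "N c = 1"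
  shows "negative_blocks 2 1 d N (\<lambda>i. if i < c then 0 else if i = c then 2 else 1)"
    (is "negative_blocks _ _ _ _ ?B")
  unfolding negative_blocks_def
proof (intro allI impI)
  fix a :: "nat \<Rightarrow> real"
  assume nz: "\<exists>j<2. a j \<noteq> 0"
  let ?g = "block_function 2 ?B a"
  have "layer_energy d N ?g = (\<Sum>i<d. (if i = c - 1 then real (N (c - 1)) * (a 0)\<^sup>2 else 0)
      + (if i = c then real (N (Suc c)) * (a 1)\<^sup>2 else 0))"
    unfolding layer_energy_def
    by (rule sum.cong) (use c N in \<open>auto simp: block_function_def\<close>)
  also have "\<dots> = real (N (c - 1)) * (a 0)\<^sup>2 + real (N (Suc c)) * (a 1)\<^sup>2"
    using c by (simp add: sum.distrib)
  finally have "layer_energy d N ?g = real (N (c - 1)) * (a 0)\<^sup>2 + real (N (Suc c)) * (a 1)\<^sup>2" .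
  moreover have "(\<Sum>i\<in>{0, c - 1, Suc c, d}. real (N i) * (?g i)\<^sup>2) \<le> layer_mass d N ?g"
    by (rule layer_mass_ge_subset) (use c in auto)
  moreover have "0 \<noteq> c - 1" "0 \<noteq> d" "c - 1 \<noteq> Suc c" "c - 1 \<noteq> d" "Suc c \<noteq> d" using c by auto
  then have "(\<Sum>i\<in>{0, c - 1, Suc c, d}. real (N i) * (?g i)\<^sup>2)
      = (a 0)\<^sup>2 + (real (N (c - 1)) * (a 0)\<^sup>2 + (real (N (Suc c)) * (a 1)\<^sup>2 + (a 1)\<^sup>2))"
    using c N by (simp add: block_function_def)
  ultimately have "layer_energy d N ?g + (a 0)\<^sup>2 + (a 1)\<^sup>2 \<le> layer_mass d N ?g" by simp
  moreover have "(a 0)\<^sup>2 + (a 1)\<^sup>2 > 0"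
    using nz by (auto simp: less_2_cases_iff sum_power2_gt_zero_iff)
  ultimately show "layer_energy d N ?g < real 1 * layer_mass d N ?g" by simp
qed

lemma ex_less_3: "(\<exists>j<3. P j) \<longleftrightarrow> P 0 \<or> P 1 \<or> P (2 :: nat)"
  by (auto simp: numeral_3_eq_3 numeral_2_eq_2 less_Suc_eq)

text \<open>
  Two cut layers that are not consecutive leave three nonempty parts without edges between them, and
  every vertex has at most one neighbour in each cut layer. So the energy is at most twice the mass.
\<close>

lemma negative_blocks_two_cut_layers:
  assumes c: "0 < c1" "c1 + 2 \<le> c2" "c2 < d"
    and N: "N 0 = 1" "N d = 1" "N c1 = 1" "N c2 = 1" "1 \<le> N (Suc c1)"
  shows "negative_blocks 3 3 d N
    (\<lambda>i. if i < c1 then 0 else if i = c1 \<or> i = c2 then 3 else if i < c2 then 1 else 2)"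
    (is "negative_blocks _ _ _ _ ?B")
  unfolding negative_blocks_def
proof (intro allI impI)
  fix a :: "nat \<Rightarrow> real"
  assume nz: "\<exists>j<3. a j \<noteq> 0"
  let ?g = "block_function 3 ?B a"
  have "layer_energy d N ?g + real (N 0) * (?g 0)\<^sup>2 + real (N d) * (?g d)\<^sup>2 \<le> 2 * layer_mass d N ?g"
    by (rule layer_energy_le_twice_mass) (use c N in \<open>auto simp: block_function_def\<close>)
  then have "layer_energy d N ?g \<le> 2 * layer_mass d N ?g" using N by (simp add: add_nonneg_nonneg)
      (smt (verit) zero_le_power2)
  moreover have "(\<Sum>i\<in>{0, Suc c1, d}. real (N i) * (?g i)\<^sup>2) \<le> layer_mass d N ?g"
    by (rule layer_mass_ge_subset) (use c in auto)
  then have "(a 0)\<^sup>2 + real (N (Suc c1)) * (a 1)\<^sup>2 + (a 2)\<^sup>2 \<le> layer_mass d N ?g"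
    using c N by (simp add: block_function_def)
  moreover have "(a 1)\<^sup>2 \<le> real (N (Suc c1)) * (a 1)\<^sup>2"
    using N(5) by (simp add: mult_le_cancel_right1)
  moreover have "(a 0)\<^sup>2 + (a 1)\<^sup>2 + (a 2)\<^sup>2 > 0"
    using nz unfolding ex_less_3
    by (smt (verit) zero_less_power2 zero_le_power2)
  ultimately show "layer_energy d N ?g < real 3 * layer_mass d N ?g" by simp
qed

text \<open>
  Here the test functions are constant except on the two end vertices, which have at most two
  neighbours each. The many vertices in between make up for the remaining energy: by the total size,
  the middle block has \<open>2 * d - 3\<close> vertices. This suffices as soon as it has at least \<open>5\<close>, and for
  \<open>d = 3\<close> it has \<open>3\<close> vertices but one of the end vertices has a single neighbour.
\<close>

lemma negative_blocks_end_layers: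
  assumes d: "3 \<le> d" and N: "N 0 = 1" "N d = 1"
    and total: "(\<Sum>i\<le>d. N i) = 2 * d - 1"
    and thin: "N 1 \<le> 2" "N (d - 1) \<le> 2"
  shows "negative_blocks 3 3 d N (\<lambda>i. if i = 0 then 0 else if i < d then 1 else 2)"
    (is "negative_blocks _ _ _ _ ?B")
  unfolding negative_blocks_def
proof (intro allI impI)
  fix a :: "nat \<Rightarrow> real"
  assume nz: "\<exists>j<3. a j \<noteq> 0"
  let ?g = "block_function 3 ?B a"
  have split: "{..d} = insert 0 (insert d {1..<d})" using d by auto
  have "(\<Sum>i\<le>d. N i) = N 0 + (N d + (\<Sum>i=1..<d. N i))"
    unfolding split using d by simp
  then have M: "(\<Sum>i=1..<d. N i) = 2 * d - 3" using N total d by linarith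
  define K where "K = real (2 * d - 3)"
  have E: "layer_energy d N ?g = real (N 1) * (a 0 - a 1)\<^sup>2 + real (N (d - 1)) * (a 1 - a 2)\<^sup>2"
  proof -
    have "layer_energy d N ?g = (\<Sum>i<d. (if i = 0 then real (N 1) * (a 0 - a 1)\<^sup>2 else 0)
        + (if i = d - 1 then real (N (d - 1)) * (a 1 - a 2)\<^sup>2 else 0))"
      unfolding layer_energy_def
      by (rule sum.cong) (use d N in \<open>auto simp: block_function_def\<close>)
    then show ?thesis using d by (simp add: sum.distrib)
  qed
  have "layer_mass d N ?g = (a 0)\<^sup>2 + ((a 2)\<^sup>2 + (\<Sum>i=1..<d. real (N i) * (?g i)\<^sup>2))"
    unfolding layer_mass_def split using d N by (simp add: block_function_def)
  also have "(\<Sum>i=1..<d. real (N i) * (?g i)\<^sup>2) = real (\<Sum>i=1..<d. N i) * (a 1)\<^sup>2"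
    unfolding of_nat_sum sum_distrib_right by (rule sum.cong) (auto simp: block_function_def)
  finally have mass: "layer_mass d N ?g = (a 0)\<^sup>2 + (a 2)\<^sup>2 + K * (a 1)\<^sup>2"
    by (simp only: M K_def add.assoc)
  have "layer_energy d N ?g < 3 * layer_mass d N ?g"
  proof (cases "d = 3")
    case True
    have M3: "N 1 + N 2 = 3" using M True by (simp add: numeral_3_eq_3 numeral_2_eq_2)
    have pos: "0 < 3 * ((a 0)\<^sup>2 + (a 2)\<^sup>2 + 3 * (a 1)\<^sup>2) - p * (a 0 - a 1)\<^sup>2 - (3 - p) * (a 1 - a 2)\<^sup>2"
      if "p = 1 \<or> p = 2" for p :: real
    proof -
      have one: "0 < 3 * (x\<^sup>2 + z\<^sup>2 + 3 * y\<^sup>2) - (x - y)\<^sup>2 - 2 * (y - z)\<^sup>2"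
        if "x \<noteq> 0 \<or> y \<noteq> 0 \<or> z \<noteq> 0" for x y z :: real
      proof -
        have "3 * (x\<^sup>2 + z\<^sup>2 + 3 * y\<^sup>2) - (x - y)\<^sup>2 - 2 * (y - z)\<^sup>2
            = (z + 2 * y)\<^sup>2 + (x + y)\<^sup>2 + x\<^sup>2 + y\<^sup>2"
          by (simp add: power2_eq_square algebra_simps)
        moreover have "x\<^sup>2 > 0 \<or> y\<^sup>2 > 0 \<or> (z + 2 * y)\<^sup>2 > 0"
          using that by (cases "x = 0"; cases "y = 0") auto
        ultimately show ?thesis by (smt (verit) zero_le_power2)
      qed
      show ?thesis
        using that one[of "a 0" "a 1" "a 2"] one[of "a 2" "a 1" "a 0"] nz
        unfolding ex_less_3 by (auto simp: power2_commute algebra_simps)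
    qed
    have "N 1 = 1 \<or> N 1 = 2" using M3 thin True by auto
    then show ?thesis
      using pos[of "real (N 1)"] M3 True unfolding E mass by (auto simp: K_def)
  next
    case False
    then have "5 \<le> K" using d by (simp add: K_def)
    then have "5 * (a 1)\<^sup>2 \<le> K * (a 1)\<^sup>2" by (rule mult_right_mono) simp
    then have "3 * ((a 0)\<^sup>2 + (a 2)\<^sup>2 + 5 * (a 1)\<^sup>2) \<le> 3 * layer_mass d N ?g"
      unfolding mass by simp
    moreover have "layer_energy d N ?g \<le> 2 * (a 0 - a 1)\<^sup>2 + 2 * (a 1 - a 2)\<^sup>2"
      unfolding E using thin by (intro add_mono mult_right_mono) auto
    moreover have "3 * ((a 0)\<^sup>2 + (a 2)\<^sup>2 + 5 * (a 1)\<^sup>2) - 2 * (a 0 - a 1)\<^sup>2 - 2 * (a 1 - a 2)\<^sup>2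
        = (a 0 + 2 * a 1)\<^sup>2 + (a 2 + 2 * a 1)\<^sup>2 + 3 * (a 1)\<^sup>2"
      by (simp add: power2_eq_square algebra_simps)
    moreover have "(a 0 + 2 * a 1)\<^sup>2 + (a 2 + 2 * a 1)\<^sup>2 + 3 * (a 1)\<^sup>2 > 0"
    proof (cases "a 1 = 0")
      case True
      then show ?thesis using nz unfolding ex_less_3 by (auto simp: sum_power2_gt_zero_iff)
    next
      case False
      then have "(a 1)\<^sup>2 > 0" by simp
      then show ?thesis by (smt (verit) zero_le_power2)
    qed
    ultimately show ?thesis by linarith
  qed
  then show "layer_energy d N ?g < real 3 * layer_mass d N ?g" by simp
qed

text \<open>
  With a single usable cut layer, the third block is the last vertex. It is adjacent to the second
  block, and the resulting cross term is harmless if the last vertex has one neighbour, or if it has two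
  and the second block has at least two layers.
\<close>

lemma negative_blocks_cut_layer_and_end:
  assumes c: "0 < c" "c + 2 \<le> d"
    and N: "N 0 = 1" "N d = 1" "N c = 1" "1 \<le> N (c - 1)" "1 \<le> N (Suc c)"
    and thin: "N (d - 1) = 1 \<or> (N (d - 1) = 2 \<and> c + 3 \<le> d)"
  shows "negative_blocks 3 3 d N
    (\<lambda>i. if i < c then 0 else if i = c then 3 else if i < d then 1 else 2)"
    (is "negative_blocks _ _ _ _ ?B")
  unfolding negative_blocks_def
proof (intro allI impI)
  fix a :: "nat \<Rightarrow> real"
  assume nz: "\<exists>j<3. a j \<noteq> 0"
  let ?g = "block_function 3 ?B a"
  define p where "p = real (N (c - 1))"
  define q where "q = real (N (Suc c))"
  have pq: "1 \<le> p" "1 \<le> q" using N by (auto simp: p_def q_def)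
  have E: "layer_energy d N ?g = p * (a 0)\<^sup>2 + q * (a 1)\<^sup>2 + real (N (d - 1)) * (a 1 - a 2)\<^sup>2"
  proof -
    have "layer_energy d N ?g = (\<Sum>i<d. (if i = c - 1 then p * (a 0)\<^sup>2 else 0)
        + (if i = c then q * (a 1)\<^sup>2 else 0)
        + (if i = d - 1 then real (N (d - 1)) * (a 1 - a 2)\<^sup>2 else 0))"
      unfolding layer_energy_def
      by (rule sum.cong) (use c N in \<open>auto simp: block_function_def p_def q_def\<close>)
    then show ?thesis using c by (simp add: sum.distrib)
  qed
  have p0: "(a 0)\<^sup>2 \<le> p * (a 0)\<^sup>2" "(a 1)\<^sup>2 \<le> q * (a 1)\<^sup>2"
    using pq by (auto simp: mult_le_cancel_right1)
  from thin have "layer_energy d N ?g < 3 * layer_mass d N ?g"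
  proof
    assume thin1: "N (d - 1) = 1"
    have "(\<Sum>i\<in>{c - 1, Suc c, d}. real (N i) * (?g i)\<^sup>2) \<le> layer_mass d N ?g"
      by (rule layer_mass_ge_subset) (use c in auto)
    moreover have "c - 1 \<noteq> Suc c" "c - 1 \<noteq> d" "Suc c \<noteq> d" using c by auto
    then have "(\<Sum>i\<in>{c - 1, Suc c, d}. real (N i) * (?g i)\<^sup>2)
        = p * (a 0)\<^sup>2 + (q * (a 1)\<^sup>2 + (a 2)\<^sup>2)"
      using c N by (simp add: block_function_def p_def q_def)
    ultimately have mass: "p * (a 0)\<^sup>2 + q * (a 1)\<^sup>2 + (a 2)\<^sup>2 \<le> layer_mass d N ?g" by simp
    have "2 * (a 0)\<^sup>2 + 2 * (a 1)\<^sup>2 + 3 * (a 2)\<^sup>2 - (a 1 - a 2)\<^sup>2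
        = 2 * (a 0)\<^sup>2 + (a 1 + a 2)\<^sup>2 + (a 2)\<^sup>2"
      by (simp add: power2_eq_square algebra_simps)
    moreover have "2 * (a 0)\<^sup>2 + (a 1 + a 2)\<^sup>2 + (a 2)\<^sup>2 > 0"
    proof (cases "a 2 = 0")
      case True
      then show ?thesis using nz unfolding ex_less_3
        by (smt (verit) zero_le_power2 zero_less_power2)
    next
      case False
      then have "(a 2)\<^sup>2 > 0" by simp
      then show ?thesis by (smt (verit) zero_le_power2)
    qed
    ultimately show ?thesis unfolding E using mass p0 thin1 by simp
  next
    assume thin2: "N (d - 1) = 2 \<and> c + 3 \<le> d"
    have "(\<Sum>i\<in>{c - 1, Suc c, d - 1, d}. real (N i) * (?g i)\<^sup>2) \<le> layer_mass d N ?g"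
      by (rule layer_mass_ge_subset) (use c in auto)
    moreover have "c - 1 \<noteq> Suc c" "c - 1 \<noteq> d - 1" "c - 1 \<noteq> d" "Suc c \<noteq> d - 1" "Suc c \<noteq> d"
      "d - 1 \<noteq> d" "\<not> d - 1 < c" "d - 1 \<noteq> c" "d - 1 < d" using c thin2 by auto
    then have "(\<Sum>i\<in>{c - 1, Suc c, d - 1, d}. real (N i) * (?g i)\<^sup>2)
        = p * (a 0)\<^sup>2 + (q * (a 1)\<^sup>2 + (2 * (a 1)\<^sup>2 + (a 2)\<^sup>2))"
      using c N thin2 by (simp add: block_function_def p_def q_def)
    ultimately have mass: "p * (a 0)\<^sup>2 + q * (a 1)\<^sup>2 + 2 * (a 1)\<^sup>2 + (a 2)\<^sup>2 \<le> layer_mass d N ?g"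
      by simp
    have "2 * (a 0)\<^sup>2 + 8 * (a 1)\<^sup>2 + 3 * (a 2)\<^sup>2 - 2 * (a 1 - a 2)\<^sup>2
        = 2 * (a 0)\<^sup>2 + (2 * a 1 + a 2)\<^sup>2 + 2 * (a 1)\<^sup>2"
      by (simp add: power2_eq_square algebra_simps)
    moreover have "2 * (a 0)\<^sup>2 + (2 * a 1 + a 2)\<^sup>2 + 2 * (a 1)\<^sup>2 > 0"
    proof (cases "a 1 = 0")
      case True
      then show ?thesis using nz unfolding ex_less_3
        by (smt (verit) zero_le_power2 zero_less_power2)
    next
      case False
      then have "(a 1)\<^sup>2 > 0" by simp
      then show ?thesis by (smt (verit) zero_le_power2)
    qed
    ultimately show ?thesis unfolding E using mass p0 thin2 by simp
  qed
  then show "layer_energy d N ?g < real 3 * layer_mass d N ?g" by simp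
qed

lemma layer_energy_reverse:
  "layer_energy d N (\<lambda>i. g (d - i)) = layer_energy d (\<lambda>i. N (d - i)) g"
proof -
  let ?t = "\<lambda>i. real (N (d - i)) * real (N (d - Suc i)) * (g i - g (Suc i))\<^sup>2"
  have "layer_energy d N (\<lambda>i. g (d - i)) = (\<Sum>i<d. ?t (d - Suc i))"
    unfolding layer_energy_def
  proof (rule sum.cong[OF refl])
    fix i assume "i \<in> {..<d}"
    then have "d - (d - Suc i) = Suc i" "Suc (d - Suc i) = d - i" "d - (d - i) = i" by auto
    then show "real (N i) * real (N (Suc i)) * (g (d - i) - g (d - Suc i))\<^sup>2 = ?t (d - Suc i)"
      by (simp add: power2_commute)
  qed
  also have "\<dots> = (\<Sum>i<d. ?t i)" by (rule sum.nat_diff_reindex)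
  finally show ?thesis by (simp add: layer_energy_def)
qed

lemma layer_mass_reverse:
  "layer_mass d N (\<lambda>i. g (d - i)) = layer_mass d (\<lambda>i. N (d - i)) g"
  unfolding layer_mass_def
  by (subst sum.nat_diff_reindex[of _ "Suc d", unfolded lessThan_Suc_atMost, symmetric])
     (intro sum.cong, auto)

lemma negative_blocks_reverse:
  assumes "negative_blocks m s d (\<lambda>i. N (d - i)) B"
  shows "negative_blocks m s d N (\<lambda>i. B (d - i))"
proof -
  have "block_function m (\<lambda>i. B (d - i)) c = (\<lambda>i. block_function m B c (d - i))" for c
    by (simp add: block_function_def fun_eq_iff)
  then show ?thesis
    using assms unfolding negative_blocks_def by (simp add: layer_energy_reverse layer_mass_reverse)
qed

section \<open>Finding suitable blocks from the number of vertices\<close>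

lemma interior_layers_sum:
  fixes N :: "nat \<Rightarrow> nat"
  assumes "0 < d" "N 0 = 1" "N d = 1"
  shows "(\<Sum>i\<le>d. N i) = (\<Sum>i=1..<d. N i) + 2"
proof -
  have split: "{..d} = insert 0 (insert d {1..<d})" using assms by auto
  show ?thesis unfolding split using assms by simp
qed

lemma interior_layers_lower_bound:
  fixes N :: "nat \<Rightarrow> nat" and L :: "nat \<Rightarrow> int"
  assumes "\<And>i. 1 \<le> i \<Longrightarrow> i < d \<Longrightarrow> L i \<le> int (N i)"
  shows "(\<Sum>i=1..<d. L i) \<le> int (\<Sum>i=1..<d. N i)"
  unfolding of_nat_sum using assms by (intro sum_mono) auto

lemma ex_singleton_layer:
  fixes N :: "nat \<Rightarrow> nat"
  assumes "\<And>i. i \<le> d \<Longrightarrow> 1 \<le> N i" and "(\<Sum>i=1..<d. N i) < 2 * (d - 1)"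
  shows "\<exists>c. 1 \<le> c \<and> c < d \<and> N c = 1"
proof (rule ccontr)
  assume none: "\<nexists>c. 1 \<le> c \<and> c < d \<and> N c = 1"
  have "2 \<le> N i" if i: "1 \<le> i" "i < d" for i
  proof -
    have "N i \<noteq> 1" using none i by blast
    then show ?thesis using assms(1)[of i] i by simp
  qed
  then have "(\<Sum>i=1..<d. 2) \<le> int (\<Sum>i=1..<d. N i)"
    by (intro interior_layers_lower_bound) (metis of_nat_numeral of_nat_le_iff)
  then show False using assms(2) by (cases d) auto
qed

text \<open>
  The interior layers have average size just below \<open>2\<close>: there are \<open>d - 1\<close> of them with \<open>2 * d - 3\<close>
  vertices. Each surplus vertex in one layer therefore forces an additional singleton layer. A first
  layer of size at least \<open>3\<close> forces two singletons. If no two of them are separated by another layer,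
  there are exactly two consecutive ones \<open>c\<close> and \<open>c + 1\<close>. Then there is no room for another surplus, and
  the last interior layer has at most two vertices. Thus \<open>c\<close> and the last vertex provide the blocks.
\<close>

lemma ex_negative_blocks_thick_first_layer:
  assumes d: "3 \<le> d" and N: "N 0 = 1" "N d = 1" "\<And>i. i \<le> d \<Longrightarrow> 1 \<le> N i"
    and total: "(\<Sum>i\<le>d. N i) = 2 * d - 1" and thick: "3 \<le> N 1"
  shows "\<exists>B. negative_blocks 3 3 d N B"
proof -
  have I: "(\<Sum>i=1..<d. N i) = 2 * d - 3"
    using interior_layers_sum[of d N] N total d by simp
  define Z where "Z = {i. 1 \<le> i \<and> i < d \<and> N i = 1}"
  have fin: "finite Z" unfolding Z_def by (rule finite_subset[of _ "{..<d}"]) auto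
  have "(\<Sum>i=1..<d. N i) < 2 * (d - 1)" unfolding I using d by arith
  then obtain c0 where "1 \<le> c0" "c0 < d" "N c0 = 1" using ex_singleton_layer[of d N] N(3) by blast
  then have "Z \<noteq> {}" unfolding Z_def by blast
  define c where "c = Min Z"
  have c: "c \<in> Z" and c_min: "\<And>i. i \<in> Z \<Longrightarrow> c \<le> i"
    using fin \<open>Z \<noteq> {}\<close> by (auto simp: c_def)
  have c2: "2 \<le> c"
  proof -
    have "c \<noteq> 1" using c thick by (auto simp: Z_def)
    then show ?thesis using c by (auto simp: Z_def)
  qed
  show ?thesis
  proof (cases "\<exists>c'\<in>Z. c + 2 \<le> c'")
    case True
    then obtain c' where c': "c' \<in> Z" "c + 2 \<le> c'" by blast
    then show ?thesis
      using negative_blocks_two_cut_layers[of c c' d N] c N unfolding Z_def by auto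
  next
    case False
    have two: "2 \<le> N i" if "1 \<le> i" "i < d" "i \<noteq> c" "i \<noteq> Suc c" for i
    proof -
      have "i \<notin> Z" using that False c_min[of i] by fastforce
      then show ?thesis using that N(3)[of i] by (auto simp: Z_def)
    qed
    have cd: "c < d" "N c = 1" using c by (auto simp: Z_def)
    have "Suc c \<in> Z"
    proof (rule ccontr)
      assume not: "Suc c \<notin> Z"
      \<comment> \<open>A lower bound for the layer sizes that adds up to one more than the number of
         available vertices.\<close>
      define L :: "nat \<Rightarrow> int"
        where "L i = 2 + (if i = 1 then 1 else 0) - (if i = c then 1 else 0)" for i
      have "L i \<le> int (N i)" if i: "1 \<le> i" "i < d" for i
        using two[of i] N(3)[of i] i thick c2 not by (cases "i = Suc c") (auto simp: L_def Z_def)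
      then have "(\<Sum>i=1..<d. L i) \<le> int (2 * d - 3)"
        unfolding I[symmetric] by (rule interior_layers_lower_bound)
      moreover have "(\<Sum>i=1..<d. L i) = 2 * (int d - 1)"
        using cd c2 d by (simp add: L_def sum.distrib sum_subtractf of_nat_diff)
      ultimately show False using d by simp
    qed
    then have Sc: "Suc c < d" "N (Suc c) = 1" by (auto simp: Z_def)
    have "N (d - 1) = 1 \<or> (N (d - 1) = 2 \<and> c + 3 \<le> d)"
    proof (cases "Suc c = d - 1")
      case True
      then show ?thesis using Sc by simp
    next
      case far: False
      have "N (d - 1) \<le> 2"
      proof (rule ccontr)
        assume "\<not> N (d - 1) \<le> 2"
        then have last: "3 \<le> N (d - 1)" by simp
        define L :: "nat \<Rightarrow> int"
          where "L i = 2 + (if i = 1 then 1 else 0) + (if i = d - 1 then 1 else 0)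
            - (if i = c then 1 else 0) - (if i = Suc c then 1 else 0)" for i
        have "L i \<le> int (N i)" if i: "1 \<le> i" "i < d" for i
          using two[of i] N(3)[of i] i thick last c2 cd Sc far by (auto simp: L_def)
        then have "(\<Sum>i=1..<d. L i) \<le> int (2 * d - 3)"
          unfolding I[symmetric] by (rule interior_layers_lower_bound)
        moreover have "(\<Sum>i=1..<d. L i) = 2 * (int d - 1)"
          using cd Sc c2 d by (simp add: L_def sum.distrib sum_subtractf of_nat_diff)
        ultimately show False using d by simp
      qed
      moreover have "2 \<le> N (d - 1)" using two[of "d - 1"] far Sc d by auto
      ultimately show ?thesis using far Sc by auto
    qed
    then show ?thesis
      using negative_blocks_cut_layer_and_end[of c d N] c2 cd Sc N by auto
  qed
qed

text \<open>
  Reversing the order of the layers reduces a thick last interior layer to a thick first one.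
\<close>

lemma ex_negative_blocks_dim_3:
  assumes d: "3 \<le> d" and N: "N 0 = 1" "N d = 1" "\<And>i. i \<le> d \<Longrightarrow> 1 \<le> N i"
    and total: "(\<Sum>i\<le>d. N i) = 2 * d - 1"
  shows "\<exists>B. negative_blocks 3 3 d N B"
proof -
  consider "3 \<le> N 1" | "3 \<le> N (d - 1)" | "N 1 \<le> 2" "N (d - 1) \<le> 2" by linarith
  then show ?thesis
  proof cases
    case 1
    then show ?thesis using ex_negative_blocks_thick_first_layer[OF d N total] by blast
  next
    case 2
    have "(\<Sum>i\<le>d. N (d - i)) = 2 * d - 1"
      using sum.nat_diff_reindex[of N "Suc d"] total by (simp add: lessThan_Suc_atMost)
    then have "\<exists>B. negative_blocks 3 3 d (\<lambda>i. N (d - i)) B"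
      using d N 2 by (intro ex_negative_blocks_thick_first_layer) auto
    then show ?thesis using negative_blocks_reverse by blast
  next
    case 3
    then show ?thesis using negative_blocks_end_layers[OF d N(1,2) total] by blast
  qed
qed

text \<open>
  The interior layers fall three vertices short of average size \<open>2\<close>, so at least three of them are
  singletons, and at most two of these are next to an end.
\<close>

lemma ex_deep_singleton_layer:
  fixes N :: "nat \<Rightarrow> nat"
  assumes d: "3 \<le> d" and "\<And>i. i \<le> d \<Longrightarrow> 1 \<le> N i" and "(\<Sum>i=1..<d. N i) + 5 = 2 * d"
  shows "\<exists>c. 2 \<le> c \<and> c + 2 \<le> d \<and> N c = 1"
proof (rule ccontr)
  assume none: "\<nexists>c. 2 \<le> c \<and> c + 2 \<le> d \<and> N c = 1"
  define L :: "nat \<Rightarrow> int"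
    where "L i = 2 - (if i = 1 then 1 else 0) - (if i = d - 1 then 1 else 0)" for i
  have "L i \<le> int (N i)" if i: "1 \<le> i" "i < d" for i
  proof (cases "i = 1 \<or> i = d - 1")
    case True
    then show ?thesis using assms(2)[of i] i by (auto simp: L_def)
  next
    case False
    then have "2 \<le> i" "i + 2 \<le> d" using i by auto
    then have "N i \<noteq> 1" using none by blast
    then show ?thesis using False assms(2)[of i] i by (simp add: L_def)
  qed
  then have "(\<Sum>i=1..<d. L i) \<le> int (\<Sum>i=1..<d. N i)"
    by (rule interior_layers_lower_bound)
  also have "(\<Sum>i=1..<d. N i) = 2 * d - 5" using assms(3) by linarith
  finally have "(\<Sum>i=1..<d. L i) \<le> int (2 * d - 5)" .
  moreover have "(\<Sum>i=1..<d. L i) = 2 * (int d - 1) - 2"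
    using d by (simp add: L_def sum_subtractf of_nat_diff)
  ultimately show False using d by simp
qed

section \<open>Layers of a graph of given diameter\<close>

context graph
begin

definition walk_dist :: "'a \<Rightarrow> 'a \<Rightarrow> nat" where
  "walk_dist u v = (LEAST k. \<exists>p. awalk u p v \<and> length p = k)"

lemma walk_dist_le: "awalk u p v \<Longrightarrow> walk_dist u v \<le> length p"
  unfolding walk_dist_def by (rule Least_le) blast

lemma walk_dist_attained:
  assumes "u \<rightarrow>\<^sup>*\<^bsub>G\<^esub> v"
  obtains p where "awalk u p v" "length p = walk_dist u v"
proof -
  have "\<exists>k p. awalk u p v \<and> length p = k" using assms unfolding reachable_awalk by blast
  then have "\<exists>p. awalk u p v \<and> length p = walk_dist u v"
    unfolding walk_dist_def by (rule LeastI_ex)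
  then show thesis using that by blast
qed

lemma graph_dist_eq_walk_dist:
  assumes "u \<rightarrow>\<^sup>*\<^bsub>G\<^esub> v"
  shows "graph_dist G u v = ereal (real (walk_dist u v))"
proof -
  have cost: "awalk_cost (\<lambda>_. 1) p = real (length p)" for p
    by (induction p) simp_all
  obtain p where p: "awalk u p v" "length p = walk_dist u v"
    using walk_dist_attained[OF assms] by blast
  show ?thesis unfolding graph_dist_def
  proof (rule antisym)
    show "\<mu> (\<lambda>_. 1) u v \<le> ereal (real (walk_dist u v))"
      using min_cost_le_walk_cost[OF p(1), of "\<lambda>_. 1"] p(2) by (simp add: cost)
    show "ereal (real (walk_dist u v)) \<le> \<mu> (\<lambda>_. 1) u v"
      unfolding \<mu>_def cost by (rule INF_greatest) (use walk_dist_le in simp)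
  qed
qed

lemma walk_dist_self:
  assumes "u \<in> verts G"
  shows "walk_dist u u = 0"
  using walk_dist_le[of u "[]" u] assms by (simp add: awalk_Nil_iff)

lemma walk_dist_adj_le:
  assumes "u \<rightarrow>\<^sup>*\<^bsub>G\<^esub> x" "x \<rightarrow>\<^bsub>G\<^esub> y"
  shows "walk_dist u y \<le> Suc (walk_dist u x)"
proof -
  obtain p where p: "awalk u p x" "length p = walk_dist u x"
    using walk_dist_attained[OF assms(1)] by blast
  obtain e where e: "e \<in> arcs G" "tail G e = x" "head G e = y"
    using assms(2) unfolding arcs_ends_def arc_to_ends_def by blast
  have "awalk x [e] y" using arc_implies_awalk[OF e(1)] unfolding e .
  from walk_dist_le[OF awalk_appendI[OF p(1) this]] show ?thesis using p(2) by simp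
qed

lemma walk_dist_intermediate:
  assumes "u \<rightarrow>\<^sup>*\<^bsub>G\<^esub> v" "i \<le> walk_dist u v"
  shows "\<exists>x\<in>verts G. walk_dist u x = i"
  using assms
proof (induction arbitrary: i rule: reachable_induct)
  case base
  from base(2) walk_dist_self[OF base(1)] have "i = 0" by simp
  then show ?case using walk_dist_self[OF base(1)] base(1) by blast
next
  case (step x y)
  show ?case
  proof (cases "i \<le> walk_dist u x")
    case True
    then show ?thesis using step.IH by blast
  next
    case False
    then have "walk_dist u y = i"
      using step.prems walk_dist_adj_le[OF step.hyps(1,2)] by simp
    then show ?thesis using adj_in_verts(2)[OF step.hyps(2)] by blast
  qed
qed

text \<open>
  The distance from an end \<open>u\<close> of a diametral pair is truncated to \<open>{1..d - 1}\<close> at all vertices other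
  than the two ends. So vertices at distance \<open>d\<close> from \<open>u\<close> other than \<open>v\<close> move down to layer \<open>d - 1\<close>.
  Adjacent vertices still lie in equal or consecutive layers, and both end layers are now singletons.
\<close>

lemma diameter_layering:
  assumes conn: "connected G" and diam: "graph_diameter G = ereal (real d)" and d: "2 \<le> d"
  obtains l u v where
    "\<forall>x. l x \<le> d"
    "\<forall>x y. x \<rightarrow>\<^bsub>G\<^esub> y \<longrightarrow> l y \<le> Suc (l x)"
    "\<forall>i\<le>d. \<exists>x\<in>verts G. l x = i"
    "u \<in> verts G" "v \<in> verts G"
    "\<forall>x. l x = 0 \<longleftrightarrow> x = u" "\<forall>x. l x = d \<longleftrightarrow> x = v"
proof -
  have sc: "strongly_connected G"
    using symmetric_connected_imp_strongly_connected[OF sym_arcs conn] .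
  have reach: "x \<rightarrow>\<^sup>*\<^bsub>G\<^esub> y" if "x \<in> verts G" "y \<in> verts G" for x y
    using sc that by (auto simp: strongly_connected_def)
  have ne: "verts G \<noteq> {}" using sc by (auto simp: strongly_connected_def)
  let ?D = "{graph_dist G u v |u v. u \<in> verts G \<and> v \<in> verts G}"
  have "?D = (\<lambda>(u, v). graph_dist G u v) ` (verts G \<times> verts G)" by auto
  then have "finite ?D" by simp
  moreover have "?D \<noteq> {}" using ne by auto
  ultimately have "graph_diameter G \<in> ?D" unfolding graph_diameter_def by (rule Max_in)
  then obtain u v where uv: "u \<in> verts G" "v \<in> verts G" "graph_dist G u v = ereal (real d)"
    using diam by auto
  then have dv: "walk_dist u v = d" using graph_dist_eq_walk_dist[OF reach[OF uv(1,2)]] by simp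
  have neq: "u \<noteq> v" using dv d walk_dist_self[OF uv(1)] by auto
  define l where
    "l x = (if x = u then 0 else if x = v then d else max 1 (min (d - 1) (walk_dist u x)))" for x
  have lu: "l x = 0 \<longleftrightarrow> x = u" for x using d by (auto simp: l_def)
  have lv: "l x = d \<longleftrightarrow> x = v" for x using d neq by (auto simp: l_def)
  have ld: "l x \<le> d" for x using d by (auto simp: l_def)
  have lip: "l y \<le> Suc (l x)" if xy: "x \<rightarrow>\<^bsub>G\<^esub> y" for x y
  proof -
    have V: "x \<in> verts G" "y \<in> verts G" by (rule adj_in_verts[OF xy])+
    have "walk_dist u y \<le> Suc (walk_dist u x)"
      by (rule walk_dist_adj_le[OF reach[OF uv(1) V(1)] xy])
    moreover have "walk_dist u u = 0" by (rule walk_dist_self[OF uv(1)])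
    ultimately show ?thesis
      using d dv unfolding l_def by (cases "y = u"; cases "y = v"; cases "x = u"; cases "x = v") simp_all
  qed
  have layer: "\<exists>x\<in>verts G. l x = i" if i: "i \<le> d" for i
  proof -
    consider "i = 0" | "i = d" | "0 < i" "i < d" using i by linarith
    then show ?thesis
    proof cases
      case 1
      then show ?thesis using lu[of u] uv(1) by auto
    next
      case 2
      then show ?thesis using lv[of v] uv(2) by auto
    next
      case 3
      obtain x where x: "x \<in> verts G" "walk_dist u x = i"
        using walk_dist_intermediate[OF reach[OF uv(1,2)], of i] dv i by auto
      have "x \<noteq> u" "x \<noteq> v" using x 3 dv walk_dist_self[OF uv(1)] by auto
      then have "l x = i" using x 3 by (auto simp: l_def)
      then show ?thesis using x by blast
    qed
  qed
  show thesis
    using that[of l u v] ld lip layer lu lv uv(1,2) by presburger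
qed

end

section \<open>Laplacian eigenvalues and diameter\<close>

theorem theorem1p5:
  fixes G :: "('a, 'b) pre_digraph" and n d :: nat
  assumes "graph G"
    and "Digraph_Component.connected G"
    and "card (verts G) = n"
    and "graph_diameter G = ereal (real d)"
  shows "(d = 2 \<or> real d = (real n + 2) / 2 \<or> real d = (real n + 3) / 2 \<longrightarrow>
            int (laplacian_count G {real n - 2 * real d + 4 .. real n}) \<le> int n - 2) \<and>
         (3 \<le> d \<and> int d \<le> \<lfloor>(real n + 1) / 2\<rfloor> \<longrightarrow>
            int (laplacian_count G {real n - 2 * real d + 4 .. real n}) \<le> int n - 3)"
proof -
  interpret graph G by fact
  have sc: "strongly_connected G"
    by (rule symmetric_connected_imp_strongly_connected[OF sym_arcs assms(2)])
  have "verts G \<noteq> {}"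
    using sc unfolding strongly_connected_def by (rule conjunct1)
  then have n0: "0 < n" using assms(3) finite_verts card_gt_0_iff[of "verts G"] by simp
  let ?I = "{real n - 2 * real d + 4 .. real n}"
  have main: "(d = 2 \<or> n + 2 = 2 * d \<or> n + 3 = 2 * d \<longrightarrow> laplacian_count G ?I + 2 \<le> n) \<and>
      (3 \<le> d \<and> 2 * d \<le> n + 1 \<longrightarrow> laplacian_count G ?I + 3 \<le> n)" if d: "2 \<le> d"
  proof -
    obtain l u v where all_l: "\<forall>x. l x \<le> d"
      and all_lip: "\<forall>x y. x \<rightarrow>\<^bsub>G\<^esub> y \<longrightarrow> l y \<le> Suc (l x)"
      and layer: "\<forall>i\<le>d. \<exists>x\<in>verts G. l x = i"
      and uv: "u \<in> verts G" "v \<in> verts G"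
      and all_lu: "\<forall>x. l x = 0 \<longleftrightarrow> x = u" and all_lv: "\<forall>x. l x = d \<longleftrightarrow> x = v"
      by (rule diameter_layering[OF assms(2,4) d])
    note l = all_l[rule_format] and lip = all_lip[rule_format]
      and lu = all_lu[rule_format] and lv = all_lv[rule_format]
    define N where "N S i = card {x \<in> S. l x = i}" for S i
    have count: "laplacian_count G ?I + m \<le> n"
      if "S \<subseteq> verts G" "u \<in> S" "negative_blocks m s d (N S) B" and s: "s + 2 * d = card S + 4"
      for m s S B
    proof -
      have eq: "real s + real n - real (card S) = real n - 2 * real d + 4" using s by linarith
      have "S \<noteq> {}" using that(2) by blast
      from laplacian_count_layers[OF that(1) this l lip that(3)[unfolded N_def], of "real n"]
      show ?thesis unfolding assms(3) eq .
    qed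
    have N0: "N S 0 = 1" if "u \<in> S" for S
    proof -
      have "{x \<in> S. l x = 0} = {u}" using that lu by auto
      then show ?thesis by (simp add: N_def)
    qed
    have Nd: "N S d = 1" if "v \<in> S" for S
    proof -
      have "{x \<in> S. l x = d} = {v}" using that lv by auto
      then show ?thesis by (simp add: N_def)
    qed
    have total: "(\<Sum>i\<le>d. N S i) = card S" if "S \<subseteq> verts G" for S
    proof -
      have "finite S" using that finite_subset finite_verts by blast
      from sum_over_layers[OF this l, of "\<lambda>_. 1"] show ?thesis
        by (simp add: N_def flip: of_nat_sum)
    qed
    \<comment> \<open>One representative of each layer, so that vertex sets containing all of them have
       nonempty layers.\<close>
    obtain r where r: "\<And>i. i \<le> d \<Longrightarrow> r i \<in> verts G \<and> l (r i) = i"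
      using layer by metis
    have N1: "1 \<le> N S i" if "r ` {..d} \<subseteq> S" "S \<subseteq> verts G" "i \<le> d" for S i
    proof -
      have "finite {x \<in> S. l x = i}" using that finite_subset[OF _ finite_verts] by fastforce
      moreover have "r i \<in> {x \<in> S. l x = i}" using that r by auto
      ultimately have "0 < card {x \<in> S. l x = i}" unfolding card_gt_0_iff by blast
      then show ?thesis by (simp add: N_def)
    qed
    have "inj_on r {..d}" by (rule inj_onI) (metis atMost_iff r)
    then have cr: "card (r ` {..d}) = Suc d" by (simp add: card_image)
    have rV: "r ` {..d} \<subseteq> verts G" using r by auto
    have r0: "r 0 = u" "r d = v" using r[of 0] r[of d] lu lv by auto
    have nd: "Suc d \<le> n" using card_mono[OF finite_verts rV] cr assms(3) by simp
    let ?V = "verts G"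
    note NV0 = N0[OF uv(1)] and NVd = Nd[OF uv(2)] and NV1 = N1[OF rV order_refl]
    have IV: "(\<Sum>i=1..<d. N ?V i) + 2 = n"
      using interior_layers_sum[of d "N ?V"] NV0 NVd total[of ?V] assms(3) d by simp
    have case2: "laplacian_count G ?I + 2 \<le> n" if d2: "d = 2"
    proof -
      \<comment> \<open>The two ends alone: their layers are \<open>0\<close> and \<open>2\<close>, and layer \<open>1\<close> is empty.\<close>
      let ?S = "{u, v}"
      have lS: "l u = 0" "l v = d" using lu[of u] lv[of v] by simp_all
      then have neq: "u \<noteq> v" using d by auto
      have "{x \<in> ?S. l x = 1} = {}" using lS d2 by auto
      then have "N ?S 1 \<le> 1" unfolding N_def by (simp only: card.empty)
      then have "negative_blocks 2 2 d (N ?S) (\<lambda>i. if i < 1 then 0 else if i = 1 then 2 else 1)"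
        using N0[of ?S] Nd[of ?S] d2 by (intro negative_blocks_cut_layer) auto
      from count[OF _ _ this] show ?thesis using uv neq d2 by simp
    qed
    have case_half: "laplacian_count G ?I + 2 \<le> n" if "n + 2 = 2 * d"
    proof -
      have d3: "3 \<le> d" using that nd by simp
      have "(\<Sum>i=1..<d. N ?V i) < 2 * (d - 1)" using IV that d3 by linarith
      then obtain c where c: "1 \<le> c" "c < d" "N ?V c = 1"
        using ex_singleton_layer[of d "N ?V"] NV1 by blast
      have "negative_blocks 2 2 d (N ?V) (\<lambda>i. if i < c then 0 else if i = c then 2 else 1)"
        using c NV0 NVd by (intro negative_blocks_cut_layer) auto
      from count[OF _ _ this] show ?thesis using uv that assms(3) by simp
    qed
    have case_half': "laplacian_count G ?I + 2 \<le> n" if "n + 3 = 2 * d"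
    proof -
      have d3: "3 \<le> d" using that nd by simp
      have "(\<Sum>i=1..<d. N ?V i) + 5 = 2 * d" using IV that by linarith
      then obtain c where c: "2 \<le> c" "c + 2 \<le> d" "N ?V c = 1"
        using ex_deep_singleton_layer[OF d3, of "N ?V"] NV1 by blast
      have "negative_blocks 2 1 d (N ?V) (\<lambda>i. if i < c then 0 else if i = c then 2 else 1)"
        using c NV0 NVd by (intro negative_blocks_deep_cut_layer) auto
      from count[OF _ _ this] show ?thesis using uv that assms(3) by simp
    qed
    have case_small: "laplacian_count G ?I + 3 \<le> n" if d3: "3 \<le> d" and small: "2 * d \<le> n + 1"
    proof -
      \<comment> \<open>A subgraph on \<open>2 * d - 1\<close> vertices meets the threshold \<open>3\<close>. It must be this small: the
         surplus counting of the layers depends on the number of vertices.\<close>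
      have "card (r ` {..d}) \<le> 2 * d - 1" "2 * d - 1 \<le> card ?V"
        unfolding cr assms(3) using d3 small by linarith+
      from exists_subset_between[OF this rV finite_verts]
      obtain S where S: "r ` {..d} \<subseteq> S" "S \<subseteq> ?V" "card S = 2 * d - 1" by blast
      have uvS: "u \<in> S" "v \<in> S" using S(1) r0 by auto
      obtain B where "negative_blocks 3 3 d (N S) B"
        using ex_negative_blocks_dim_3[OF d3 N0[OF uvS(1)] Nd[OF uvS(2)] N1[OF S(1,2)]]
          total[OF S(2)] S(3) by auto
      from count[OF S(2) uvS(1) this] show ?thesis
        using S(3) d3 by simp
    qed
    show ?thesis using case2 case_half case_half' case_small by blast
  qed
  have "real d = (real n + 2) / 2 \<longleftrightarrow> real (n + 2) = real (2 * d)" by auto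
  then have half: "real d = (real n + 2) / 2 \<longleftrightarrow> n + 2 = 2 * d" unfolding of_nat_eq_iff .
  have "real d = (real n + 3) / 2 \<longleftrightarrow> real (n + 3) = real (2 * d)" by auto
  then have half': "real d = (real n + 3) / 2 \<longleftrightarrow> n + 3 = 2 * d" unfolding of_nat_eq_iff .
  have "int d \<le> \<lfloor>(real n + 1) / 2\<rfloor> \<longleftrightarrow> real (2 * d) \<le> real (n + 1)"
    unfolding le_floor_iff by auto
  then have floor: "int d \<le> \<lfloor>(real n + 1) / 2\<rfloor> \<longleftrightarrow> 2 * d \<le> n + 1" unfolding of_nat_le_iff .
  \<comment> \<open>For \<open>d < 2\<close> the hypotheses of both parts are inconsistent with \<open>0 < n\<close>.\<close>
  show ?thesis
  proof (cases "2 \<le> d")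
    case True
    then show ?thesis using main unfolding half half' floor by auto
  next
    case False
    then show ?thesis using n0 unfolding half half' floor by auto
  qed
qed

end
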